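(* Let $M$ be a lattice of rank $n$, $N=\mathrm{Hom}(M,\mathbb{Z})$, $M_{\mathbb{R}}=M\otimes\mathbb{R}$, $N_{\mathbb{R}}=N\otimes\mathbb{R}$. Let $\mathcal{A}_0,\dots,\mathcal{A}_n\subset M$ be finite supports, $\Delta_i=\mathrm{conv}(\mathcal{A}_i)$ and $\Delta=\Delta_0+\dots+\Delta_n$ (assumed $n$-dimensional). Let $\mathcal{H}\subset N_{\mathbb{R}}$ be the hyperplane arrangement associated to $\Delta$, take $v\in N_{\mathbb{R}}\setminus\mathcal{H}$, and let $\lambda_0>\lambda_1>\dots>\lambda_n\ge 0$ be real numbers that are sufficiently small. Define the liftings $\omega_i:\mathcal{A}_i\to\mathbb{R}$, $\omega_i(x)=\lambda_i\langle v,x\rangle$, and let $\rho=(\omega_0,\dots,\omega_n)$. Then the mixed subdivision $S(\rho)$ of $\Delta$ is admissible.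
   Context: Hyperplane arrangement of $\Delta$: the union in $N_{\mathbb{R}}$ of the linear spans of the $(n-1)$-dimensional cones of the (inner) normal fan of $\Delta$. A lifting $\theta=(\theta_0,\dots,\theta_n)\in\prod_i\mathbb{R}^{\mathcal{A}_i}$ induces a coherent mixed subdivision $S(\theta)$ of $\Delta$: its cells are the projections of the lower faces of $\sum_i\mathrm{conv}\{(a,\theta_i(a)):a\in\mathcal{A}_i\}$; each cell has a component structure $D=D_0+\dots+D_n$ with $D_i$ a cell of the induced subdivision of $\Delta_i$. $S(\rho)$ is tight if every $n$-cell satisfies $\sum_i\dim D_i=n$. $S(\psi)$ refines $S(\phi)$ ($S(\phi)\preceq S(\psi)$) if every cell of $S(\psi)$ is contained in a cell of $S(\phi)$. Fix a generic $\delta\in M_{\mathbb{R}}$ such that every point of $\mathcal{B}=(\Delta+\delta)\cap M$ lies in the interior of a translated $n$-cell $D+\delta$ of $S(\rho)$. For $b\in\mathcal{B}$ in $D+\delta$, the type vector is $t_{b,i}=\dim D_i$, the row content is $i(b)=\max\{i: t_{b,i}=0\}$ and $a(b)$ is the point $D_{i(b)}$. An $n$-cell $C$ is $i$-mixed if $\dim C_j=1$ for all $j\neq i$ (and $\dim C_i=0$). For each $i$, let $\theta_i=(\omega_0,\dots,\omega_{i-1},0,\dots,0)$ (the zero lifting on $\mathcal{A}_i,\dots,\mathcal{A}_n$). For an $n$-cell $D=D_0+\dots+D_n$ of $S(\theta_i)$, let $\mathcal{A}_D=(\mathcal{A}_j\cap D_j)_{j=0,\dots,n}$, let $S(\rho_D)$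 be the restriction of $S(\rho)$ to $D$, $\mathcal{B}_D=\mathcal{B}\cap(D+\delta)$ and $\mathcal{B}_{D,i}=\{b\in\mathcal{B}_D: i(b)=i\}$. The fundamental subfamily of a family of supports is the set of indices $k$ such that its sparse resultant has positive degree in the coefficients of the $k$-th polynomial. An incremental chain $S(\theta_0)\preceq\dots\preceq S(\theta_n)$ is admissible if for each $i$ every $n$-cell $D$ of $S(\theta_i)$ satisfies either (i) the fundamental subfamily of $\mathcal{A}_D$ contains at most one support, or (ii) $\mathcal{B}_{D,i}$ is contained in the union of the translated $i$-mixed cells of $S(\rho_D)$. $S(\rho)$ is admissible if it admits an admissible incremental chain $S(\theta_0)\preceq\dots\preceq S(\theta_n)\preceq S(\rho)$.
   Formalization: "Sufficiently small" is read successively: each λ_i lies below a positive threshold depending on λ_0,…,λ_{i-1} (and on the supports and v); with one common threshold the claim is false, since scaling all liftings leaves S(ρ) unchanged. *)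

theory Defs
  imports
    "HOL-Analysis.Analysis"
    "HOL-Library.Poly_Mapping"
    "HOL-Library.Set_Algebras"
    "HOL-Computational_Algebra.Factorial_Ring"
begin

text \<open>
  A lattice \<open>M\<close> of rank \<open>n\<close> is a full lattice \<open>L\<close> in a Euclidean space \<open>'a\<close>, which plays the role of
  the real vector space of \<open>M\<close>; hence \<open>n = DIM('a)\<close>. The dual space is identified with \<open>'a\<close> through
  the inner product, the pairing of \<open>v\<close> and \<open>x\<close> being \<open>v \<bullet> x\<close>. Families indexed by \<open>0, \<dots>, n\<close> are
  functions on \<open>nat\<close> of which only the values at indices \<open>\<le> DIM('a)\<close> matter. Sums of sets are
  Minkowski sums.
\<close>

definition full_lattice :: "'a::euclidean_space set \<Rightarrow> bool" where
  "full_lattice L \<longleftrightarrow> (\<exists>B. independent B \<and> span B = UNIV \<and>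
     L = {(\<Sum>b\<in>B. real_of_int (c b) *\<^sub>R b) | c. True})"


section \<open>Polytopes and the hyperplane arrangement\<close>

definition cell_sum :: "(nat \<Rightarrow> 'a::euclidean_space set) \<Rightarrow> 'a set" where
  "cell_sum D = (\<Sum>i\<le>DIM('a). D i)"

definition newton_sum :: "(nat \<Rightarrow> 'a::euclidean_space set) \<Rightarrow> 'a set" where
  "newton_sum A = cell_sum (\<lambda>i. convex hull (A i))"

definition inner_normal_cone :: "'a::euclidean_space set \<Rightarrow> 'a set \<Rightarrow> 'a set" where
  "inner_normal_cone P F = {u. \<forall>x\<in>F. \<forall>y\<in>P. u \<bullet> x \<le> u \<bullet> y}"

definition normal_fan :: "'a::euclidean_space set \<Rightarrow> 'a set set" where
  "normal_fan P = {inner_normal_cone P F | F. F face_of P \<and> F \<noteq> {}}"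

definition hyperplane_arrangement :: "'a::euclidean_space set \<Rightarrow> 'a set" where
  "hyperplane_arrangement P =
     \<Union> {span \<sigma> | \<sigma>. \<sigma> \<in> normal_fan P \<and> aff_dim \<sigma> = int DIM('a) - 1}"


section \<open>Coherent mixed subdivisions\<close>

definition lifted_polytope ::
    "(nat \<Rightarrow> 'a::euclidean_space set) \<Rightarrow> (nat \<Rightarrow> 'a \<Rightarrow> real) \<Rightarrow> nat \<Rightarrow> ('a \<times> real) set" where
  "lifted_polytope A \<theta> i = convex hull ((\<lambda>a. (a, \<theta> i a)) ` A i)"

definition lifted_sum ::
    "(nat \<Rightarrow> 'a::euclidean_space set) \<Rightarrow> (nat \<Rightarrow> 'a \<Rightarrow> real) \<Rightarrow> ('a \<times> real) set" where
  "lifted_sum A \<theta> = (\<Sum>i\<le>DIM('a). lifted_polytope A \<theta> i)"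

definition lower_face ::
    "('a::euclidean_space \<times> real) set \<Rightarrow> 'a \<Rightarrow> ('a \<times> real) set" where
  "lower_face P u = {p \<in> P. \<forall>q\<in>P. (u, 1) \<bullet> p \<le> (u, 1) \<bullet> q}"

definition mixed_subdivision ::
    "(nat \<Rightarrow> 'a::euclidean_space set) \<Rightarrow> (nat \<Rightarrow> 'a \<Rightarrow> real) \<Rightarrow> 'a set set" where
  "mixed_subdivision A \<theta> = {fst ` lower_face (lifted_sum A \<theta>) u | u. True}"

text \<open>
  A decomposed cell is a cell given as the family \<open>(D\<^sub>0, \<dots>, D\<^sub>n)\<close> of its components; the cell
  itself is the sum \<open>cell_sum D\<close>.
\<close>

definition cell_components ::
    "(nat \<Rightarrow> 'a::euclidean_space set) \<Rightarrow> (nat \<Rightarrow> 'a \<Rightarrow> real) \<Rightarrow> 'a \<Rightarrow> nat \<Rightarrow> 'a set" where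
  "cell_components A \<theta> u i = fst ` lower_face (lifted_polytope A \<theta> i) u"

definition decomposed_cells ::
    "(nat \<Rightarrow> 'a::euclidean_space set) \<Rightarrow> (nat \<Rightarrow> 'a \<Rightarrow> real) \<Rightarrow> (nat \<Rightarrow> 'a set) set" where
  "decomposed_cells A \<theta> = {cell_components A \<theta> u | u. True}"

lemma lower_face_plus: "lower_face (P + Q) u = lower_face P u + lower_face Q u"
proof (intro set_eqI iffI)
  fix x assume "x \<in> lower_face (P + Q) u"
  then have x: "x \<in> P + Q" and min: "\<And>y. y \<in> P + Q \<Longrightarrow> (u, 1) \<bullet> x \<le> (u, 1) \<bullet> y"
    by (auto simp: lower_face_def)
  from x obtain p q where pq: "x = p + q" "p \<in> P" "q \<in> Q" by (auto elim: set_plus_elim)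
  have "(u, 1) \<bullet> p \<le> (u, 1) \<bullet> p'" if "p' \<in> P" for p'
    using min[of "p' + q"] that pq by (simp add: set_plus_intro inner_add_right)
  moreover have "(u, 1) \<bullet> q \<le> (u, 1) \<bullet> q'" if "q' \<in> Q" for q'
    using min[of "p + q'"] that pq by (simp add: set_plus_intro inner_add_right)
  ultimately show "x \<in> lower_face P u + lower_face Q u"
    using pq by (auto simp: lower_face_def intro!: set_plus_intro)
next
  fix x assume "x \<in> lower_face P u + lower_face Q u"
  then obtain p q where pq: "x = p + q" "p \<in> lower_face P u" "q \<in> lower_face Q u"
    by (auto elim: set_plus_elim)
  show "x \<in> lower_face (P + Q) u"
    unfolding lower_face_def
  proof (intro CollectI conjI ballI)
    show "x \<in> P + Q" using pq by (auto simp: lower_face_def intro!: set_plus_intro)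
    fix y assume "y \<in> P + Q"
    then obtain p' q' where "y = p' + q'" "p' \<in> P" "q' \<in> Q" by (auto elim: set_plus_elim)
    then show "(u, 1) \<bullet> x \<le> (u, 1) \<bullet> y"
      using pq by (auto simp: lower_face_def inner_add_right intro!: add_mono)
  qed
qed

lemma lower_face_sum:
  "finite I \<Longrightarrow> lower_face (\<Sum>i\<in>I. P i) u = (\<Sum>i\<in>I. lower_face (P i) u)"
  by (induction I rule: finite_induct) (auto simp: lower_face_plus, auto simp: lower_face_def)

lemma fst_image_set_plus: "fst ` (S + T) = fst ` S + fst ` T"
  by (force simp: set_plus_def image_iff)

lemma fst_image_sum: "finite I \<Longrightarrow> fst ` (\<Sum>i\<in>I. S i) = (\<Sum>i\<in>I. fst ` S i)"
  by (induction I rule: finite_induct) (auto simp: fst_image_set_plus)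

text \<open>
  The lower face of the sum selected by \<open>u\<close> is the sum of the lower faces selected by \<open>u\<close>, so that
  the decomposed cells are exactly the cells together with their component structure.
\<close>

lemma cell_sum_cell_components:
  "cell_sum (cell_components A \<theta> u) = fst ` lower_face (lifted_sum A \<theta>) u"
  unfolding cell_sum_def cell_components_def lifted_sum_def
  by (simp add: lower_face_sum fst_image_sum)

lemma mixed_subdivision_eq: "mixed_subdivision A \<theta> = cell_sum ` decomposed_cells A \<theta>"
  unfolding mixed_subdivision_def decomposed_cells_def
  by (simp add: full_SetCompr_eq image_image cell_sum_cell_components)

definition n_cells ::
    "(nat \<Rightarrow> 'a::euclidean_space set) \<Rightarrow> (nat \<Rightarrow> 'a \<Rightarrow> real) \<Rightarrow> (nat \<Rightarrow> 'a set) set" where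
  "n_cells A \<theta> = {D \<in> decomposed_cells A \<theta>. aff_dim (cell_sum D) = int DIM('a)}"

definition refined_by :: "'a set set \<Rightarrow> 'a set set \<Rightarrow> bool" (infix "\<preceq>" 50) where
  "S \<preceq> T \<longleftrightarrow> (\<forall>C\<in>T. \<exists>D\<in>S. C \<subseteq> D)"

definition i_mixed :: "nat \<Rightarrow> (nat \<Rightarrow> 'a::euclidean_space set) \<Rightarrow> bool" where
  "i_mixed i C \<longleftrightarrow> aff_dim (C i) = 0 \<and> (\<forall>j\<le>DIM('a). j \<noteq> i \<longrightarrow> aff_dim (C j) = 1)"


section \<open>Translated lattice points and the row content\<close>

definition translated_cell :: "'a::euclidean_space \<Rightarrow> (nat \<Rightarrow> 'a set) \<Rightarrow> 'a set" where
  "translated_cell \<delta> D = (+) \<delta> ` cell_sum D"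

definition shifted_points ::
    "'a::euclidean_space set \<Rightarrow> (nat \<Rightarrow> 'a set) \<Rightarrow> 'a \<Rightarrow> 'a set" where
  "shifted_points L A \<delta> = ((+) \<delta> ` newton_sum A) \<inter> L"

definition generic_shift ::
    "'a::euclidean_space set \<Rightarrow> (nat \<Rightarrow> 'a set) \<Rightarrow> (nat \<Rightarrow> 'a \<Rightarrow> real) \<Rightarrow> 'a \<Rightarrow> bool" where
  "generic_shift L A \<rho> \<delta> \<longleftrightarrow>
     (\<forall>b\<in>shifted_points L A \<delta>. \<exists>D\<in>n_cells A \<rho>. b \<in> interior (translated_cell \<delta> D))"

text \<open>
  The row content of \<open>b\<close> is the largest index of a component that is a point. It is a relation
  because no component need be a point when the subdivision is not tight.
\<close>

definition has_row_content ::
    "(nat \<Rightarrow> 'a::euclidean_space set) \<Rightarrow> (nat \<Rightarrow> 'a \<Rightarrow> real) \<Rightarrow> 'a \<Rightarrow> 'a \<Rightarrow> nat \<Rightarrow> bool" where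
  "has_row_content A \<rho> \<delta> b i \<longleftrightarrow>
     (\<exists>C\<in>n_cells A \<rho>. b \<in> interior (translated_cell \<delta> C) \<and>
        i \<le> DIM('a) \<and> aff_dim (C i) = 0 \<and> (\<forall>j\<le>DIM('a). aff_dim (C j) = 0 \<longrightarrow> j \<le> i))"

definition row_points ::
    "'a::euclidean_space set \<Rightarrow> (nat \<Rightarrow> 'a set) \<Rightarrow> (nat \<Rightarrow> 'a \<Rightarrow> real) \<Rightarrow> 'a \<Rightarrow>
     (nat \<Rightarrow> 'a set) \<Rightarrow> nat \<Rightarrow> 'a set" where
  "row_points L A \<rho> \<delta> D i =
     {b \<in> shifted_points L A \<delta> \<inter> translated_cell \<delta> D. has_row_content A \<rho> \<delta> b i}"


section \<open>The sparse resultant and the fundamental subfamily\<close>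

text \<open>
  The generic coefficients are the variables \<open>u\<^sub>i\<^sub>,\<^sub>a\<close>, written \<open>(i, a)\<close>, with \<open>i \<le> n\<close> and \<open>a \<in> A i\<close>.
  Polynomials in them are finitely supported functions on monomials. A complex coefficient vector
  is a function vanishing off the set of variables.
\<close>

type_synonym 'x mono = "'x \<Rightarrow>\<^sub>0 nat"

definition poly_vars :: "('x mono \<Rightarrow>\<^sub>0 'r::zero) \<Rightarrow> 'x set" where
  "poly_vars P = (\<Union>m\<in>Poly_Mapping.keys P. Poly_Mapping.keys m)"

definition poly_eval ::
    "('r \<Rightarrow> complex) \<Rightarrow> ('x mono \<Rightarrow>\<^sub>0 'r::zero) \<Rightarrow> ('x \<Rightarrow> complex) \<Rightarrow> complex" where
  "poly_eval h P c = (\<Sum>m\<in>Poly_Mapping.keys P. h (Poly_Mapping.lookup P m) *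
     (\<Prod>x\<in>Poly_Mapping.keys m. c x ^ Poly_Mapping.lookup m x))"

definition coeff_vars :: "(nat \<Rightarrow> 'a::euclidean_space set) \<Rightarrow> (nat \<times> 'a) set" where
  "coeff_vars A = {(i, a). i \<le> DIM('a) \<and> a \<in> A i}"

definition coeff_space :: "(nat \<Rightarrow> 'a::euclidean_space set) \<Rightarrow> (nat \<times> 'a \<Rightarrow> complex) set" where
  "coeff_space A = {c. \<forall>x. x \<notin> coeff_vars A \<longrightarrow> c x = 0}"

text \<open>The torus is the set of group homomorphisms from \<open>L\<close> to the nonzero complex numbers.\<close>

definition torus :: "'a::euclidean_space set \<Rightarrow> ('a \<Rightarrow> complex) set" where
  "torus L = {\<tau> \<in> extensional L.
     (\<forall>x\<in>L. \<tau> x \<noteq> 0) \<and> (\<forall>x\<in>L. \<forall>y\<in>L. \<tau> (x + y) = \<tau> x * \<tau> y)}"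

definition incidence ::
    "'a::euclidean_space set \<Rightarrow> (nat \<Rightarrow> 'a set) \<Rightarrow> ((nat \<times> 'a \<Rightarrow> complex) \<times> ('a \<Rightarrow> complex)) set" where
  "incidence L A = {(c, \<tau>). c \<in> coeff_space A \<and> \<tau> \<in> torus L \<and>
     (\<forall>i\<le>DIM('a). (\<Sum>a\<in>A i. c (i, a) * \<tau> a) = 0)}"

definition zariski_closure ::
    "(nat \<Rightarrow> 'a::euclidean_space set) \<Rightarrow> (nat \<times> 'a \<Rightarrow> complex) set \<Rightarrow> (nat \<times> 'a \<Rightarrow> complex) set" where
  "zariski_closure A X = {c \<in> coeff_space A.
     \<forall>P :: (nat \<times> 'a) mono \<Rightarrow>\<^sub>0 complex. poly_vars P \<subseteq> coeff_vars A \<longrightarrow>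
       (\<forall>x\<in>X. poly_eval id P x = 0) \<longrightarrow> poly_eval id P c = 0}"

definition elimination_variety ::
    "'a::euclidean_space set \<Rightarrow> (nat \<Rightarrow> 'a set) \<Rightarrow> (nat \<times> 'a \<Rightarrow> complex) set" where
  "elimination_variety L A = zariski_closure A (fst ` incidence L A)"

definition eliminant_equation ::
    "'a::euclidean_space set \<Rightarrow> (nat \<Rightarrow> 'a set) \<Rightarrow> ((nat \<times> 'a) mono \<Rightarrow>\<^sub>0 int) \<Rightarrow> bool" where
  "eliminant_equation L A P \<longleftrightarrow> irreducible P \<and> poly_vars P \<subseteq> coeff_vars A \<and>
     elimination_variety L A = {c \<in> coeff_space A. poly_eval of_int P c = 0}"

text \<open>
  The eliminant is an irreducible integral equation of the elimination variety if that is a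
  hypersurface, and 1 otherwise. The variety is defined over the rationals and irreducible, so it
  is a hypersurface exactly when such an equation exists, and the equation is unique up to sign.
\<close>

definition sparse_eliminant ::
    "'a::euclidean_space set \<Rightarrow> (nat \<Rightarrow> 'a set) \<Rightarrow> (nat \<times> 'a) mono \<Rightarrow>\<^sub>0 int" where
  "sparse_eliminant L A =
     (if \<exists>P. eliminant_equation L A P then SOME P. eliminant_equation L A P else 1)"

text \<open>
  The degree of the projection of the incidence variety onto its image closure is the number of
  points of a generic fibre. The incidence variety is irreducible of codimension \<open>n + 1\<close> in the
  product with the torus, so generic fibres are finite whenever the image closure is a hypersurface.
\<close>

definition projection_degree :: "'a::euclidean_space set \<Rightarrow> (nat \<Rightarrow> 'a set) \<Rightarrow> nat" where
  "projection_degree L A = (THE d. \<exists>G :: (nat \<times> 'a) mono \<Rightarrow>\<^sub>0 complex.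
     poly_vars G \<subseteq> coeff_vars A \<and>
     (\<exists>c\<in>elimination_variety L A. poly_eval id G c \<noteq> 0) \<and>
     (\<forall>c\<in>elimination_variety L A. poly_eval id G c \<noteq> 0 \<longrightarrow>
        finite {\<tau>. (c, \<tau>) \<in> incidence L A} \<and> card {\<tau>. (c, \<tau>) \<in> incidence L A} = d))"

text \<open>
  The resultant is the primitive equation of the direct image cycle of the incidence variety,
  which is the image closure counted with the degree of the projection. It is determined up to
  sign. The coefficient spaces are affine, not projective, so that the resultant of a
  family having a single one-point support \<open>A\<^sub>k = {a}\<close> can be a power of \<open>u\<^sub>k\<^sub>,\<^sub>a\<close>.
\<close>

definition sparse_resultant ::
    "'a::euclidean_space set \<Rightarrow> (nat \<Rightarrow> 'a set) \<Rightarrow> (nat \<times> 'a) mono \<Rightarrow>\<^sub>0 int" where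
  "sparse_resultant L A = sparse_eliminant L A ^ projection_degree L A"

definition degree_in :: "nat \<Rightarrow> ((nat \<times> 'a) mono \<Rightarrow>\<^sub>0 int) \<Rightarrow> nat" where
  "degree_in k P = Max (insert 0
     ((\<lambda>m. \<Sum>x\<in>{x \<in> Poly_Mapping.keys m. fst x = k}. Poly_Mapping.lookup m x) `
        Poly_Mapping.keys P))"

definition fundamental_subfamily ::
    "'a::euclidean_space set \<Rightarrow> (nat \<Rightarrow> 'a set) \<Rightarrow> nat set" where
  "fundamental_subfamily L A = {k. k \<le> DIM('a) \<and> degree_in k (sparse_resultant L A) > 0}"


section \<open>Admissible mixed subdivisions\<close>

definition partial_lifting :: "(nat \<Rightarrow> 'a \<Rightarrow> real) \<Rightarrow> nat \<Rightarrow> nat \<Rightarrow> 'a \<Rightarrow> real" where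
  "partial_lifting \<omega> i j = (if j < i then \<omega> j else (\<lambda>_. 0))"

definition incremental_chain ::
    "(nat \<Rightarrow> 'a::euclidean_space set) \<Rightarrow> (nat \<Rightarrow> 'a \<Rightarrow> real) \<Rightarrow> bool" where
  "incremental_chain A \<omega> \<longleftrightarrow> (\<forall>i<DIM('a).
     mixed_subdivision A (partial_lifting \<omega> i) \<preceq> mixed_subdivision A (partial_lifting \<omega> (Suc i)))"

definition restricted_supports ::
    "(nat \<Rightarrow> 'a::euclidean_space set) \<Rightarrow> (nat \<Rightarrow> 'a set) \<Rightarrow> nat \<Rightarrow> 'a set" where
  "restricted_supports A D j = A j \<inter> D j"

definition restricted_n_cells ::
    "(nat \<Rightarrow> 'a::euclidean_space set) \<Rightarrow> (nat \<Rightarrow> 'a \<Rightarrow> real) \<Rightarrow> (nat \<Rightarrow> 'a set) \<Rightarrow> (nat \<Rightarrow> 'a set) set" where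
  "restricted_n_cells A \<rho> D = {C \<in> n_cells A \<rho>. cell_sum C \<subseteq> cell_sum D}"

definition admissible_level ::
    "'a::euclidean_space set \<Rightarrow> (nat \<Rightarrow> 'a set) \<Rightarrow> (nat \<Rightarrow> 'a \<Rightarrow> real) \<Rightarrow> 'a \<Rightarrow>
     nat \<Rightarrow> (nat \<Rightarrow> 'a \<Rightarrow> real) \<Rightarrow> bool" where
  "admissible_level L A \<rho> \<delta> i \<theta> \<longleftrightarrow> (\<forall>D\<in>n_cells A \<theta>.
     card (fundamental_subfamily L (restricted_supports A D)) \<le> 1 \<or>
     row_points L A \<rho> \<delta> D i \<subseteq>
       \<Union> {translated_cell \<delta> C | C. C \<in> restricted_n_cells A \<rho> D \<and> i_mixed i C})"

text \<open>
  The chain is the one built from the components of \<open>\<rho> = (\<omega>\<^sub>0, \<dots>, \<omega>\<^sub>n)\<close> itself.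
\<close>

definition admissible ::
    "'a::euclidean_space set \<Rightarrow> (nat \<Rightarrow> 'a set) \<Rightarrow> (nat \<Rightarrow> 'a \<Rightarrow> real) \<Rightarrow> 'a \<Rightarrow> bool" where
  "admissible L A \<rho> \<delta> \<longleftrightarrow>
     incremental_chain A \<rho> \<and>
     mixed_subdivision A (partial_lifting \<rho> DIM('a)) \<preceq> mixed_subdivision A \<rho> \<and>
     (\<forall>i\<le>DIM('a). admissible_level L A \<rho> \<delta> i (partial_lifting \<rho> i))"

text \<open>
  Multiplying all liftings by a positive constant leaves every mixed subdivision unchanged, so
  smallness of the \<open>\<lambda>\<^sub>i\<close> has content only relative to one another: \<open>\<lambda>\<^sub>i\<close> lies below a positive
  threshold depending on \<open>\<lambda>\<^sub>0, \<dots>, \<lambda>\<^sub>i\<^sub>-\<^sub>1\<close>.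
\<close>

definition successively_below :: "nat \<Rightarrow> (real list \<Rightarrow> real) \<Rightarrow> (nat \<Rightarrow> real) \<Rightarrow> bool" where
  "successively_below n \<epsilon> lam \<longleftrightarrow> (\<forall>i\<le>n. lam i < \<epsilon> (map lam [0..<i]))"

end

theory Submission
  imports Defs "HOL-Computational_Algebra.Fundamental_Theorem_Algebra"
begin

text \<open>
  With linear liftings the \<open>j\<close>-th component of the cell selected by \<open>u\<close> is the face of the \<open>j\<close>-th
  polytope on which \<open>u + \<mu>\<^sub>j v\<close> is minimal. As \<open>v\<close> avoids the hyperplane arrangement, the direction
  space of such a face is either zero or not contained in the orthogonal complement of \<open>v\<close>.
  If \<open>x\<^sub>0 + \<dots> + x\<^sub>n = 0\<close> with each \<open>x\<^sub>j\<close> in the direction space of the \<open>j\<close>-th component, then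
  summing \<open>(u + \<mu>\<^sub>j v) \<bullet> x\<^sub>j = 0\<close> gives \<open>\<Sum> \<mu>\<^sub>j (v \<bullet> x\<^sub>j) = 0\<close>. Only finitely many families of direction
  spaces occur, so for rapidly decreasing \<open>\<mu>\<close> this forces all \<open>v \<bullet> x\<^sub>j\<close> with \<open>\<mu>\<^sub>j \<noteq> 0\<close> to vanish.

  Let \<open>D\<close> be an \<open>n\<close>-cell of the \<open>i\<close>-th subdivision of the chain. If \<open>D\<^sub>j\<close> is a point for some \<open>j < i\<close>,
  then the eliminant of the restricted supports involves no variable of the other supports.
  Otherwise let \<open>C \<subseteq> D\<close> be an \<open>n\<close>-cell of the finest subdivision with row content \<open>i\<close>. Vectors not
  orthogonal to \<open>v\<close> chosen from the direction spaces of \<open>D\<^sub>j\<close> for \<open>j < i\<close> and of \<open>C\<^sub>j\<close> for \<open>j > i\<close> form a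
  basis, and comparing coordinates in it shows that every \<open>C\<^sub>j\<close> with \<open>j \<noteq> i\<close> is a segment.
\<close>

section \<open>The resultant of a family with a one-point support\<close>

text \<open>Induction on the variables. The terms whose exponent of the new variable
  \<open>y\<close> is \<open>f y\<close> form, by the induction hypothesis, a coefficient that is
  nonzero for suitable values of the old variables. The resulting polynomial in \<open>y\<close> has
  finitely many roots, and \<open>0\<close> is avoided together with them. The last assumption says
  that distinct exponents are distinct monomials in \<open>S\<close>.\<close>

lemma exists_nonvanishing_point:
  fixes h :: "('x \<Rightarrow> nat) \<Rightarrow> complex"
  assumes "finite S" "finite K" "f \<in> K" "h f \<noteq> 0"
    and "\<And>f g. f \<in> K \<Longrightarrow> g \<in> K \<Longrightarrow> \<forall>z\<in>S. f z = g z \<Longrightarrow> f = g"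
  shows "\<exists>c. (\<forall>z. c z \<noteq> 0) \<and> (\<Sum>f\<in>K. h f * (\<Prod>z\<in>S. c z ^ f z)) \<noteq> 0"
  using assms
proof (induction S arbitrary: K f rule: finite_induct)
  case empty
  then have "K = {f}" by auto
  then show ?case using empty by (intro exI[of _ "\<lambda>_. 1"]) auto
next
  case (insert y S)
  define K' where "K' = {g \<in> K. g y = f y}"
  have "\<exists>c. (\<forall>z. c z \<noteq> 0) \<and> (\<Sum>g\<in>K'. h g * (\<Prod>z\<in>S. c z ^ g z)) \<noteq> 0"
    using insert.prems by (intro insert.IH) (auto simp: K'_def)
  then obtain c where c: "\<And>z. c z \<noteq> 0" "(\<Sum>g\<in>K'. h g * (\<Prod>z\<in>S. c z ^ g z)) \<noteq> 0"
    by blast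
  define p where "p = (\<Sum>g\<in>K. monom (h g * (\<Prod>z\<in>S. c z ^ g z)) (g y))"
  have "coeff p (f y) = (\<Sum>g\<in>K. if g y = f y then h g * (\<Prod>z\<in>S. c z ^ g z) else 0)"
    unfolding p_def by (simp add: coeff_sum)
  also have "\<dots> = (\<Sum>g\<in>K'. h g * (\<Prod>z\<in>S. c z ^ g z))"
    unfolding K'_def using insert.prems(1) by (intro sum.mono_neutral_cong_right) auto
  finally have "p \<noteq> 0" using c(2) by auto
  then have "finite (insert 0 {t. poly p t = 0})" by (simp add: poly_roots_finite)
  then obtain t where t: "t \<notin> insert 0 {t. poly p t = 0}"
    by (meson ex_new_if_finite infinite_UNIV_char_0)
  have eq: "(\<Sum>g\<in>K. h g * (\<Prod>z\<in>insert y S. (c(y := t)) z ^ g z)) = poly p t"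
  proof -
    have "(\<Prod>z\<in>S. (c(y := t)) z ^ g z) = (\<Prod>z\<in>S. c z ^ g z)" for g
      using insert.hyps by (intro prod.cong) auto
    then show ?thesis
      using insert.hyps by (simp add: p_def poly_sum poly_monom algebra_simps)
  qed
  show ?case
    by (rule exI[of _ "c(y := t)"]) (use c(1) t eq in auto)
qed

text \<open>Read as a polynomial in \<open>y\<close>, \<open>P\<close> keeps a nonzero coefficient
  at a positive power of \<open>y\<close> for suitable nonzero values of the other variables. It is
  then nonconstant and has a complex root. That root may be \<open>0\<close>, hence the exception
  for \<open>y\<close>.\<close>

lemma poly_eval_of_int_vanishing_point:
  fixes P :: "'x mono \<Rightarrow>\<^sub>0 int"
  assumes y: "y \<in> poly_vars P"
  shows "\<exists>c. poly_eval of_int P c = 0 \<and> (\<forall>z. z \<noteq> y \<longrightarrow> c z \<noteq> 0)"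
proof -
  let ?K = "Poly_Mapping.keys P" and ?l = Poly_Mapping.lookup
  from y obtain m where m: "m \<in> ?K" "y \<in> Poly_Mapping.keys m" by (auto simp: poly_vars_def)
  define S where "S = poly_vars P - {y}"
  \<comment> \<open>These exponents share the power of \<open>y\<close> occurring in
    \<open>m\<close>, so their terms make up the coefficient of that power. Two of them that agree
    on \<open>S\<close> are equal: they agree at \<open>y\<close>, and exponents outside
    \<open>poly_vars P\<close> are zero.\<close>
  define K where "K = {g \<in> ?l ` ?K. g y = ?l m y}"
  define h :: "('x \<Rightarrow> nat) \<Rightarrow> complex" where "h g = of_int (?l P (Abs_poly_mapping g))" for g
  have fin: "finite (poly_vars P)" by (simp add: poly_vars_def)
  have keys: "?l m' z = 0" if "m' \<in> ?K" "z \<notin> poly_vars P" for m' z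
    using that by (auto simp: poly_vars_def in_keys_iff)
  have "\<exists>c. (\<forall>z. c z \<noteq> 0) \<and> (\<Sum>f\<in>K. h f * (\<Prod>z\<in>S. c z ^ f z)) \<noteq> 0"
  proof (rule exists_nonvanishing_point[of S K "?l m"])
    show "h (?l m) \<noteq> 0" using m by (simp add: h_def lookup_inverse in_keys_iff)
    show "f = g" if "f \<in> K" "g \<in> K" "\<forall>z\<in>S. f z = g z" for f g
    proof
      fix z show "f z = g z"
        using that keys by (cases "z \<in> S") (auto simp: K_def S_def)
    qed
  qed (use fin m in \<open>auto simp: S_def K_def\<close>)
  then obtain c where c: "\<And>z. c z \<noteq> 0" "(\<Sum>f\<in>K. h f * (\<Prod>z\<in>S. c z ^ f z)) \<noteq> 0" by blast
  define p where "p = (\<Sum>m\<in>?K. monom (of_int (?l P m) * (\<Prod>z\<in>S. c z ^ ?l m z)) (?l m y))"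
  have "coeff p (?l m y) =
      (\<Sum>m'\<in>?K. if ?l m' y = ?l m y then of_int (?l P m') * (\<Prod>z\<in>S. c z ^ ?l m' z) else 0)"
    unfolding p_def by (simp add: coeff_sum)
  also have "\<dots> = (\<Sum>m'\<in>{m'\<in>?K. ?l m' y = ?l m y}. of_int (?l P m') * (\<Prod>z\<in>S. c z ^ ?l m' z))"
    by (intro sum.mono_neutral_cong_right) auto
  also have "\<dots> = (\<Sum>f\<in>K. h f * (\<Prod>z\<in>S. c z ^ f z))"
    by (rule sum.reindex_bij_witness[of _ Abs_poly_mapping ?l])
       (auto simp: K_def h_def lookup_inverse)
  finally have "coeff p (?l m y) \<noteq> 0" using c(2) by simp
  moreover have "?l m y \<noteq> 0" using m by (simp add: in_keys_iff)
  ultimately have "degree p \<noteq> 0" using le_degree by fastforce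
  then have "\<not> constant (poly p)" by (simp add: constant_degree)
  then obtain t where t: "poly p t = 0" using fundamental_theorem_of_algebra by blast
  have ev: "poly_eval of_int P (c(y := t)) = poly p t"
  proof -
    have "(\<Prod>x\<in>Poly_Mapping.keys m'. (c(y := t)) x ^ ?l m' x) =
        (\<Prod>z\<in>S. c z ^ ?l m' z) * t ^ ?l m' y" if m': "m' \<in> ?K" for m'
    proof -
      have "(\<Prod>x\<in>Poly_Mapping.keys m'. (c(y := t)) x ^ ?l m' x) =
          (\<Prod>x\<in>poly_vars P. (c(y := t)) x ^ ?l m' x)"
        using fin m' by (intro prod.mono_neutral_left) (auto simp: poly_vars_def in_keys_iff)
      also have "\<dots> = (c(y := t)) y ^ ?l m' y * (\<Prod>x\<in>S. (c(y := t)) x ^ ?l m' x)"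
        unfolding S_def using fin y by (rule prod.remove)
      also have "(\<Prod>x\<in>S. (c(y := t)) x ^ ?l m' x) = (\<Prod>x\<in>S. c x ^ ?l m' x)"
        by (rule prod.cong) (auto simp: S_def)
      finally show ?thesis by simp
    qed
    then show ?thesis
      by (simp add: poly_eval_def p_def poly_sum poly_monom algebra_simps)
  qed
  show ?thesis using ev t c(1) by (intro exI[of _ "c(y := t)"]) auto
qed

section \<open>Variables and partial degrees of polynomials\<close>

lemma poly_eval_cong:
  assumes "\<And>x. x \<in> poly_vars P \<Longrightarrow> c x = d x"
  shows "poly_eval h P c = poly_eval h P d"
proof -
  have "c x = d x" if "m \<in> Poly_Mapping.keys P" "x \<in> Poly_Mapping.keys m" for m x
    using that assms[of x] by (auto simp: poly_vars_def)
  then show ?thesis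
    unfolding poly_eval_def by (intro sum.cong prod.cong arg_cong2[of _ _ _ _ "(*)"]) auto
qed

lemma poly_vars_mult: "poly_vars (P * Q) \<subseteq> poly_vars P \<union> poly_vars Q"
  for P Q :: "'x mono \<Rightarrow>\<^sub>0 'r::comm_semiring_1"
proof
  fix x assume "x \<in> poly_vars (P * Q)"
  then obtain m where m: "m \<in> Poly_Mapping.keys (P * Q)" "x \<in> Poly_Mapping.keys m"
    by (auto simp: poly_vars_def)
  then obtain a b where "m = a + b" "a \<in> Poly_Mapping.keys P" "b \<in> Poly_Mapping.keys Q"
    using keys_mult[of P Q] by blast
  then show "x \<in> poly_vars P \<union> poly_vars Q"
    using m keys_add[of a b] by (auto simp: poly_vars_def)
qed

lemma poly_vars_power: "poly_vars (P ^ n) \<subseteq> poly_vars P"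
  for P :: "'x mono \<Rightarrow>\<^sub>0 'r::comm_semiring_1"
proof (induction n)
  case (Suc n)
  then show ?case using poly_vars_mult[of P "P ^ n"] by auto
qed (simp add: poly_vars_def)

lemma degree_in_eq_0:
  assumes "\<And>x. x \<in> poly_vars P \<Longrightarrow> fst x \<noteq> k"
  shows "degree_in k P = 0"
proof -
  have "{x \<in> Poly_Mapping.keys m. fst x = k} = {}" if "m \<in> Poly_Mapping.keys P" for m
    using that assms by (fastforce simp: poly_vars_def)
  then have "(\<lambda>m. \<Sum>x\<in>{x \<in> Poly_Mapping.keys m. fst x = k}. Poly_Mapping.lookup m x) `
      Poly_Mapping.keys P \<subseteq> {0}"
    by (force)
  then have "insert 0 ((\<lambda>m. \<Sum>x\<in>{x \<in> Poly_Mapping.keys m. fst x = k}. Poly_Mapping.lookup m x) `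
      Poly_Mapping.keys P) = {0}" by blast
  then show ?thesis unfolding degree_in_def by (simp only: Max_singleton)
qed

text \<open>On the incidence variety equation \<open>j\<close> is the single term
  \<open>c (j, a) * \<tau> a\<close>, where \<open>\<tau> a\<close> is nonzero because
  \<open>a\<close> lies in \<open>L\<close>. So a coordinate function vanishes on the projection,
  and hence on its Zariski closure.\<close>

lemma elimination_variety_singleton_support:
  fixes A :: "nat \<Rightarrow> 'a::euclidean_space set"
  assumes "j \<le> DIM('a)" "A j = {a}" "a \<in> L" "c \<in> elimination_variety L A"
  shows "c (j, a) = 0"
proof -
  define X :: "(nat \<times> 'a) mono \<Rightarrow>\<^sub>0 complex"
    where "X = Poly_Mapping.single (Poly_Mapping.single (j, a) 1) 1"
  have ev: "poly_eval id X d = d (j, a)" for d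
    by (simp add: X_def poly_eval_def)
  have "poly_vars X \<subseteq> coeff_vars A"
    using assms by (simp add: X_def poly_vars_def coeff_vars_def)
  moreover have "d (j, a) = 0" if "(d, \<tau>) \<in> incidence L A" for d \<tau>
  proof -
    have "(\<Sum>a\<in>A j. d (j, a) * \<tau> a) = 0" "\<tau> a \<noteq> 0"
      using that assms by (auto simp: incidence_def torus_def)
    then show ?thesis using assms by simp
  qed
  ultimately show ?thesis
    using assms(4) unfolding elimination_variety_def zariski_closure_def
    by (fastforce simp: ev)
qed

text \<open>
  An equation of the elimination variety involving another variable could be solved for that
  variable at a point where the coefficient of the one-point support does not vanish.
\<close>

lemma fundamental_subfamily_singleton_support:
  fixes A :: "nat \<Rightarrow> 'a::euclidean_space set"
  assumes "j \<le> DIM('a)" "A j = {a}" "a \<in> L"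
  shows "fundamental_subfamily L A \<subseteq> {j}"
proof -
  have "poly_vars P \<subseteq> {(j, a)}" if P: "eliminant_equation L A P" for P
  proof (rule ccontr)
    assume "\<not> ?thesis"
    then obtain y where y: "y \<in> poly_vars P" "y \<noteq> (j, a)" by auto
    from poly_eval_of_int_vanishing_point[OF y(1)]
    obtain c where c: "poly_eval of_int P c = 0" "\<And>z. z \<noteq> y \<Longrightarrow> c z \<noteq> 0" by blast
    \<comment> \<open>Cutting \<open>c\<close> off outside the variables moves it into
      \<open>coeff_space A\<close> without changing the value of \<open>P\<close>, all of whose
      variables lie in \<open>coeff_vars A\<close>.\<close>
    define d where "d z = (if z \<in> coeff_vars A then c z else 0)" for z
    have "poly_eval of_int P d = 0"
    proof -
      have "poly_eval of_int P d = poly_eval of_int P c"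
        using P by (intro poly_eval_cong) (auto simp: eliminant_equation_def d_def)
      then show ?thesis using c(1) by simp
    qed
    then have "d \<in> elimination_variety L A"
      using P by (auto simp: eliminant_equation_def coeff_space_def d_def)
    then have "d (j, a) = 0" using elimination_variety_singleton_support[of j A a L d] assms by simp
    then show False using c(2)[of "(j, a)"] y assms by (auto simp: d_def coeff_vars_def)
  qed
  \<comment> \<open>Whether the eliminant is a chosen equation or the default \<open>1\<close>, its
    only possible variable is \<open>(j, a)\<close>, and this passes to the power defining the
    resultant.\<close>
  moreover have "eliminant_equation L A (sparse_eliminant L A) \<or> sparse_eliminant L A = 1"
    unfolding sparse_eliminant_def using someI_ex[of "eliminant_equation L A"] by argo
  moreover have "poly_vars (1 :: (nat \<times> 'a) mono \<Rightarrow>\<^sub>0 int) = {}"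
    by (simp add: poly_vars_def)
  ultimately have "poly_vars (sparse_eliminant L A) \<subseteq> {(j, a)}"
    by (metis empty_subsetI)
  then have "poly_vars (sparse_resultant L A) \<subseteq> {(j, a)}"
    unfolding sparse_resultant_def using poly_vars_power order_trans by metis
  then have "degree_in k (sparse_resultant L A) = 0" if "k \<noteq> j" for k
    using that by (intro degree_in_eq_0) auto
  then show ?thesis unfolding fundamental_subfamily_def by fastforce
qed


section \<open>Faces selected by a linear functional\<close>

definition minimizers :: "'a::real_inner set \<Rightarrow> 'a \<Rightarrow> 'a set" where
  "minimizers S w = {x \<in> S. \<forall>y\<in>S. w \<bullet> x \<le> w \<bullet> y}"

text \<open>The linear space parallel to the affine hull of \<open>S\<close>. Working with it makes
  relations between components linear, without reference to base points.\<close>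

definition directions :: "'a::real_vector set \<Rightarrow> 'a set" where
  "directions S = span {x - y | x y. x \<in> S \<and> y \<in> S}"

lemma subspace_directions: "subspace (directions S)"
  by (simp add: directions_def)

lemma directions_diff: "x \<in> S \<Longrightarrow> y \<in> S \<Longrightarrow> x - y \<in> directions S"
  unfolding directions_def by (intro span_base) blast

lemma directions_subset:
  assumes "subspace V" "\<And>x y. x \<in> S \<Longrightarrow> y \<in> S \<Longrightarrow> x - y \<in> V"
  shows "directions S \<subseteq> V"
  unfolding directions_def using assms by (intro span_minimal) auto

lemma directions_mono: "S \<subseteq> T \<Longrightarrow> directions S \<subseteq> directions T"
  by (intro directions_subset subspace_directions directions_diff) auto

lemma span_translate_eq_directions:
  assumes "a \<in> S"
  shows "span ((\<lambda>x. x - a) ` S) = directions S"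
proof
  show "span ((\<lambda>x. x - a) ` S) \<subseteq> directions S"
    using assms by (intro span_minimal subspace_directions) (auto intro: directions_diff)
  show "directions S \<subseteq> span ((\<lambda>x. x - a) ` S)"
  proof (rule directions_subset)
    fix x y assume "x \<in> S" "y \<in> S"
    then have "(x - a) - (y - a) \<in> span ((\<lambda>x. x - a) ` S)"
      by (intro span_diff[OF span_base span_base]) auto
    then show "x - y \<in> span ((\<lambda>x. x - a) ` S)" by simp
  qed simp
qed

lemma aff_dim_eq_dim_directions:
  fixes S :: "'a::euclidean_space set"
  assumes "S \<noteq> {}"
  shows "aff_dim S = int (dim (directions S))"
proof -
  obtain a where a: "a \<in> S" using assms by auto
  have "aff_dim S = int (dim ((\<lambda>x. x - a) ` S))"
    using a by (intro aff_dim_eq_dim_subtract hull_inc)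
  then show ?thesis by (metis a dim_span span_translate_eq_directions)
qed

lemma subspace_inner_eq_0: "subspace {x. w \<bullet> x = 0}"
  by (simp add: subspace_hyperplane)

text \<open>A translate of a subspace is convex, so it contains the hull as soon as it contains
  \<open>S\<close>. This is applied first with the base point in \<open>S\<close> and then with the
  base point in the hull.\<close>

lemma directions_convex_hull: "directions (convex hull S) = directions S"
proof
  show "directions S \<subseteq> directions (convex hull S)"
    by (intro directions_mono hull_subset)
  have conv: "convex hull S \<subseteq> {x. x - a \<in> directions S}" if "\<And>x. x \<in> S \<Longrightarrow> x - a \<in> directions S" for a
  proof (rule hull_minimal)
    have "{x. x - a \<in> directions S} = (+) a ` directions S"
      using image_iff by (fastforce intro: image_eqI[of _ _ "_ - a"])
    then show "convex {x. x - a \<in> directions S}"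
      by (simp add: convex_translation subspace_imp_convex subspace_directions)
  qed (use that in auto)
  show "directions (convex hull S) \<subseteq> directions S"
  proof (intro directions_subset subspace_directions)
    fix x y assume x: "x \<in> convex hull S" and y: "y \<in> convex hull S"
    have "a - y \<in> directions S" if "a \<in> S" for a
    proof -
      have "y - a \<in> directions S" using conv[of a] y that directions_diff by blast
      then show ?thesis by (metis minus_diff_eq subspace_directions subspace_neg)
    qed
    then show "x - y \<in> directions S" using conv[of y] x by blast
  qed
qed

lemma directions_eq_0_iff:
  assumes "S \<noteq> {}"
  shows "directions S = {0} \<longleftrightarrow> (\<exists>a. S = {a})"
proof
  assume *: "directions S = {0}"
  obtain a where "a \<in> S" using assms by auto
  moreover have "x = y" if "x \<in> S" "y \<in> S" for x y
    using directions_diff[OF that] * by simp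
  ultimately have "S = {a}" by auto
  then show "\<exists>a. S = {a}" ..
qed (auto simp: directions_def)

lemma minimizers_mono_eq: "x \<in> minimizers S w \<Longrightarrow> y \<in> minimizers S w \<Longrightarrow> w \<bullet> x = w \<bullet> y"
  by (auto simp: minimizers_def intro: antisym)

lemma minimizers_orthogonal:
  assumes "x \<in> directions (minimizers S w)"
  shows "w \<bullet> x = 0"
proof -
  have "directions (minimizers S w) \<subseteq> {x. w \<bullet> x = 0}"
    by (intro directions_subset subspace_inner_eq_0)
       (auto simp: inner_diff_right dest: minimizers_mono_eq)
  then show ?thesis using assms by auto
qed

lemma minimizers_nonempty: "finite S \<Longrightarrow> S \<noteq> {} \<Longrightarrow> minimizers S w \<noteq> {}"
  using arg_min_if_finite(1)[of S "(\<bullet>) w"] arg_min_least[of S _ "(\<bullet>) w"]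
  unfolding minimizers_def by blast

text \<open>A face of a polytope is the hull of those points of the finite set that lie on it. Faces
  can therefore be handled as subsets of the supports, of which there are only finitely
  many.\<close>

lemma minimizers_convex_hull:
  fixes S :: "'a::euclidean_space set"
  assumes "finite S"
  shows "minimizers (convex hull S) w = convex hull (minimizers S w)"
proof (cases "S = {}")
  case True
  then show ?thesis by (simp add: minimizers_def)
next
  case False
  then obtain a where a: "a \<in> minimizers S w" using assms minimizers_nonempty by blast
  have "convex hull S \<subseteq> {x. w \<bullet> a \<le> w \<bullet> x}"
    using a by (intro hull_minimal convex_halfspace_ge) (auto simp: minimizers_def)
  then have ge: "w \<bullet> a \<le> w \<bullet> x" if "x \<in> convex hull S" for x using that by auto
  have aS: "a \<in> convex hull S" using a by (auto simp: minimizers_def hull_inc)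
  have eq: "minimizers (convex hull S) w = convex hull S \<inter> {x. w \<bullet> x = w \<bullet> a}"
    using ge aS by (force simp: minimizers_def)
  have "minimizers (convex hull S) w face_of convex hull S"
    unfolding eq using ge by (intro face_of_Int_supporting_hyperplane_ge) auto
  then obtain T where T: "T \<subseteq> S" "minimizers (convex hull S) w = convex hull T"
    using face_of_convex_hull_subset[of S] assms finite_imp_compact by metis
  show ?thesis
  proof
    have "T \<subseteq> minimizers (convex hull S) w" using T by (simp add: hull_subset)
    then have "T \<subseteq> minimizers S w"
      using T(1) hull_inc[of _ S convex] unfolding minimizers_def by blast
    then show "minimizers (convex hull S) w \<subseteq> convex hull (minimizers S w)"
      using T(2) by (simp add: hull_mono)
    have "convex (minimizers (convex hull S) w)" using T(2) by simp
    moreover have "minimizers S w \<subseteq> minimizers (convex hull S) w"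
      using a unfolding eq by (auto simp: hull_inc minimizers_def intro: antisym)
    ultimately show "convex hull (minimizers S w) \<subseteq> minimizers (convex hull S) w"
      by (simp add: hull_minimal)
  qed
qed

text \<open>Points of \<open>S\<close> off the face selected by \<open>w\<close> lose by a positive
  gap, which a small \<open>z\<close> cannot close. On the face itself \<open>w\<close> is constant,
  so \<open>z\<close> alone decides.\<close>

lemma minimizers_perturb:
  fixes S :: "'a::real_inner set"
  assumes "finite S"
  shows "\<exists>\<epsilon>>0. \<forall>z. norm z < \<epsilon> \<longrightarrow> minimizers S (w + z) = minimizers (minimizers S w) z"
proof (cases "S = {}")
  case True
  then show ?thesis by (intro exI[of _ "1::real"]) (simp add: minimizers_def)
next
  case False
  define M where "M = minimizers S w"
  obtain a where a: "a \<in> M" using False assms minimizers_nonempty unfolding M_def by blast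
  have "\<exists>e>0. \<forall>z. norm z < e \<longrightarrow> (w + z) \<bullet> a < (w + z) \<bullet> b" if "b \<in> S - M" for b
  proof -
    have pos: "0 < w \<bullet> (b - a)"
      using that a by (force simp: M_def minimizers_def inner_diff_right)
    have nz: "0 < norm (b - a)" using that a by auto
    \<comment> \<open>The radius is the gap divided by the distance of the two points, so that by
      Cauchy-Schwarz \<open>z\<close> changes the comparison by less than the gap.\<close>
    show ?thesis
    proof (intro exI[of _ "w \<bullet> (b - a) / norm (b - a)"] conjI allI impI)
      fix z :: 'a assume "norm z < w \<bullet> (b - a) / norm (b - a)"
      then have "norm z * norm (b - a) < w \<bullet> (b - a)" using nz by (simp add: field_simps)
      moreover have "\<bar>z \<bullet> (b - a)\<bar> \<le> norm z * norm (b - a)" by (rule Cauchy_Schwarz_ineq2)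
      ultimately show "(w + z) \<bullet> a < (w + z) \<bullet> b"
        by (simp add: inner_diff_right inner_add_left)
    qed (use pos nz in auto)
  qed
  then obtain e where e: "\<And>b. b \<in> S - M \<Longrightarrow> e b > 0"
    "\<And>b z. b \<in> S - M \<Longrightarrow> norm z < e b \<Longrightarrow> (w + z) \<bullet> a < (w + z) \<bullet> b"
    by metis
  \<comment> \<open>The entry \<open>1\<close> provides a value when no point lies off the
    face.\<close>
  define d where "d = Min (insert 1 (e ` (S - M)))"
  have "d > 0" using assms e(1) by (auto simp: d_def)
  have dle: "d \<le> e b" if "b \<in> S - M" for b
    using assms that unfolding d_def by (intro Min_le) auto
  show ?thesis
  proof (intro exI[of _ d] conjI allI impI)
    fix z :: 'a assume z: "norm z < d"
    have lt: "(w + z) \<bullet> a < (w + z) \<bullet> b" if "b \<in> S - M" for b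
      using e(2)[OF that] z dle[OF that] by simp
    have aS: "a \<in> S" using a by (auto simp: M_def minimizers_def)
    have eqM: "w \<bullet> x = w \<bullet> a" if "x \<in> M" for x
      using that a minimizers_mono_eq unfolding M_def by blast
    have MS: "M \<subseteq> S" by (auto simp: M_def minimizers_def)
    show "minimizers S (w + z) = minimizers (minimizers S w) z"
      unfolding M_def[symmetric]
    proof (intro set_eqI iffI)
      fix x assume x: "x \<in> minimizers S (w + z)"
      then have xM: "x \<in> M" using lt[of x] aS by (force simp: minimizers_def)
      have "z \<bullet> x \<le> z \<bullet> y" if "y \<in> M" for y
      proof -
        have "(w + z) \<bullet> x \<le> (w + z) \<bullet> y" using x that MS by (auto simp: minimizers_def)
        then show ?thesis using eqM[OF xM] eqM[OF that] by (simp add: inner_add_left)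
      qed
      then show "x \<in> minimizers M z" using xM by (simp add: minimizers_def)
    next
      fix x assume x: "x \<in> minimizers M z"
      then have xM: "x \<in> M" by (simp add: minimizers_def)
      have *: "(w + z) \<bullet> x \<le> (w + z) \<bullet> y" if "y \<in> M" for y
        using x that eqM[OF xM] eqM[OF that] by (simp add: minimizers_def inner_add_left)
      have "(w + z) \<bullet> x \<le> (w + z) \<bullet> y" if "y \<in> S" for y
        using *[of y] *[OF a] lt[of y] that by (cases "y \<in> M") auto
      then show "x \<in> minimizers S (w + z)" using xM MS by (auto simp: minimizers_def)
    qed
  qed (use \<open>d > 0\<close> in auto)
qed

lemma minimizers_scaleR:
  "0 < c \<Longrightarrow> minimizers S (c *\<^sub>R z) = minimizers S z"
  by (simp add: minimizers_def)

lemma minimizers_perturb_family: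
  fixes A :: "nat \<Rightarrow> 'a::real_inner set"
  assumes "\<And>j. j \<le> n \<Longrightarrow> finite (A j)"
  shows "\<exists>\<epsilon>>0. \<forall>z. norm z < \<epsilon> \<longrightarrow>
    (\<forall>j\<le>n. minimizers (A j) (w + z) = minimizers (minimizers (A j) w) z)"
proof -
  have "\<forall>j\<in>{..n}. \<exists>e>0. \<forall>z. norm z < e \<longrightarrow>
      minimizers (A j) (w + z) = minimizers (minimizers (A j) w) z"
    using minimizers_perturb[OF assms, of _ w] unfolding Ball_def atMost_iff by blast
  then obtain e where e: "\<forall>j\<in>{..n}. e j > 0 \<and> (\<forall>z. norm z < e j \<longrightarrow>
      minimizers (A j) (w + z) = minimizers (minimizers (A j) w) z)"
    by (auto dest!: bchoice)
  define d where "d = Min (e ` {..n})"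
  have "d > 0" using e by (auto simp: d_def)
  moreover have "d \<le> e j" if "j \<le> n" for j using that unfolding d_def by (intro Min_le) auto
  ultimately show ?thesis using e by (intro exI[of _ d]) force
qed

lemma minimizers_sum:
  fixes P :: "nat \<Rightarrow> 'a::real_inner set"
  assumes "finite I"
  shows "minimizers (\<Sum>i\<in>I. P i) w = (\<Sum>i\<in>I. minimizers (P i) w)"
  using assms
proof (induction I rule: finite_induct)
  case empty
  then show ?case by (auto simp: minimizers_def)
next
  case (insert i I)
  have plus: "minimizers (P + Q) w = minimizers P w + minimizers Q w" for P Q :: "'a set"
  proof (intro set_eqI iffI)
    fix x assume x: "x \<in> minimizers (P + Q) w"
    then obtain p q where pq: "x = p + q" "p \<in> P" "q \<in> Q"
      unfolding minimizers_def by (blast elim: set_plus_elim)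
    have le: "w \<bullet> x \<le> w \<bullet> (p' + q')" if "p' \<in> P" "q' \<in> Q" for p' q'
      using x set_plus_intro[OF that] by (simp add: minimizers_def)
    have "p \<in> minimizers P w" "q \<in> minimizers Q w"
      using le[of _ q] le[of p] pq by (auto simp: minimizers_def inner_add_right)
    then show "x \<in> minimizers P w + minimizers Q w" using pq by (auto intro: set_plus_intro)
  next
    fix x assume "x \<in> minimizers P w + minimizers Q w"
    then obtain p q where pq: "x = p + q" "p \<in> minimizers P w" "q \<in> minimizers Q w"
      by (auto elim: set_plus_elim)
    have "w \<bullet> x \<le> w \<bullet> y" if "y \<in> P + Q" for y
    proof -
      obtain p' q' where "y = p' + q'" "p' \<in> P" "q' \<in> Q" using \<open>y \<in> P + Q\<close> by (rule set_plus_elim)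
      then show ?thesis using pq by (simp add: minimizers_def inner_add_right add_mono)
    qed
    moreover have "x \<in> P + Q" using pq by (simp add: minimizers_def set_plus_intro)
    ultimately show "x \<in> minimizers (P + Q) w" by (simp add: minimizers_def)
  qed
  show ?case using insert by (simp add: plus)
qed


section \<open>Directions avoiding the hyperplane arrangement\<close>

abbreviation linear_lifting :: "(nat \<Rightarrow> real) \<Rightarrow> 'a::euclidean_space \<Rightarrow> nat \<Rightarrow> 'a \<Rightarrow> real" where
  "linear_lifting \<mu> v \<equiv> \<lambda>j x. \<mu> j * (v \<bullet> x)"

text \<open>Under a linear lifting the lifted polytope is the graph of a linear function over the
  hull, and on that graph the functional \<open>(u, 1)\<close> becomes \<open>u + \<mu> j v\<close>
  on the base.\<close>

lemma cell_components_linear_lifting: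
  fixes A :: "nat \<Rightarrow> 'a::euclidean_space set"
  shows "cell_components A (linear_lifting \<mu> v) u j = minimizers (convex hull A j) (u + \<mu> j *\<^sub>R v)"
proof -
  let ?f = "\<lambda>a. (a, \<mu> j * (v \<bullet> a))"
  have "linear ?f"
    by (intro linearI) (auto simp: inner_add_right algebra_simps)
  then have P: "lifted_polytope A (linear_lifting \<mu> v) j = ?f ` (convex hull A j)"
    by (simp add: lifted_polytope_def convex_hull_linear_image)
  have "(u, 1) \<bullet> ?f x = (u + \<mu> j *\<^sub>R v) \<bullet> x" for x
    by (simp add: inner_add_left)
  then have "lower_face (?f ` (convex hull A j)) u = ?f ` minimizers (convex hull A j) (u + \<mu> j *\<^sub>R v)"
    unfolding lower_face_def minimizers_def by auto
  then show ?thesis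
    unfolding cell_components_def P by (simp add: image_image)
qed

lemma minimizers_newton_sum:
  fixes A :: "nat \<Rightarrow> 'a::euclidean_space set"
  assumes "\<And>j. j \<le> DIM('a) \<Longrightarrow> finite (A j)"
  shows "minimizers (newton_sum A) w = cell_sum (\<lambda>j. convex hull (minimizers (A j) w))"
  using assms by (simp add: newton_sum_def cell_sum_def minimizers_sum minimizers_convex_hull)

section \<open>Descent from a face of one support to an edge of the Minkowski sum\<close>

lemma minimizers_eq_self:
  assumes "\<And>x. x \<in> directions S \<Longrightarrow> z \<bullet> x = 0"
  shows "minimizers S z = S"
proof -
  have "z \<bullet> x \<le> z \<bullet> y" if "x \<in> S" "y \<in> S" for x y
    using assms[OF directions_diff[OF that]] by (simp add: inner_diff_right)
  then show ?thesis by (auto simp: minimizers_def)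
qed

lemma directions_minimizers_subset: "directions (minimizers S w) \<subseteq> directions S"
  by (rule directions_mono) (auto simp: minimizers_def)

text \<open>A facet of the hull has dimension at least one here, and faces of polytopes are exposed.
  This supplies one descent step: a proper face that is still not a point.\<close>

lemma exists_minimizers_edge:
  fixes S :: "'a::euclidean_space set"
  assumes "finite S" "2 \<le> dim (directions S)"
  shows "\<exists>z. directions (minimizers S z) \<noteq> {0} \<and> \<not> directions S \<subseteq> {x. z \<bullet> x = 0}"
proof -
  have ne: "S \<noteq> {}" using assms(2) by (auto simp: directions_def)
  have S: "aff_dim (convex hull S) = int (dim (directions S))"
    using ne by (metis aff_dim_convex_hull aff_dim_eq_dim_directions)
  have poly: "polytope (convex hull S)" using assms(1) by (auto simp: polytope_def)
  then obtain F where F: "F facet_of (convex hull S)"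
    using S assms(2) polytope_facet_exists[of "convex hull S"] by auto
  then have aff: "aff_dim F = int (dim (directions S)) - 1" "F \<noteq> {}" "F face_of (convex hull S)"
    using S by (auto simp: facet_of_def)
  then have "F exposed_face_of (convex hull S)"
    using poly exposed_face_of_polyhedron polytope_imp_polyhedron by blast
  moreover have "F \<noteq> convex hull S" using aff S by auto
  ultimately obtain a b where ab: "convex hull S \<subseteq> {x. a \<bullet> x \<le> b}" "F = convex hull S \<inter> {x. a \<bullet> x = b}"
    using aff(2) unfolding exposed_face_of by auto
  obtain f where f: "f \<in> F" using aff(2) by auto
  \<comment> \<open>The exposing functional \<open>a\<close> is maximal on the facet, whence the
    sign.\<close>
  have "minimizers (convex hull S) (- a) = F"
  proof
    show "minimizers (convex hull S) (- a) \<subseteq> F"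
    proof
      fix x assume x: "x \<in> minimizers (convex hull S) (- a)"
      moreover have fb: "f \<in> convex hull S" "a \<bullet> f = b" using f ab(2) by auto
      ultimately have "(-a) \<bullet> x \<le> (-a) \<bullet> f" unfolding minimizers_def by blast
      then have "a \<bullet> x \<ge> b" using fb(2) by simp
      then show "x \<in> F" using x ab by (auto simp: minimizers_def intro: antisym)
    qed
  qed (use ab in \<open>auto simp: minimizers_def\<close>)
  then have F_eq: "F = convex hull (minimizers S (- a))"
    using minimizers_convex_hull[OF assms(1)] by simp
  have "directions F \<noteq> {0}"
  proof
    assume "directions F = {0}"
    then have "aff_dim F = 0" using aff_dim_eq_dim_directions[OF aff(2)] by simp
    then show False using aff(1) assms(2) by linarith
  qed
  then have "directions (minimizers S (- a)) \<noteq> {0}"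
    unfolding F_eq directions_convex_hull .
  moreover have "\<not> directions S \<subseteq> {x. (- a) \<bullet> x = 0}"
  proof
    assume "directions S \<subseteq> {x. (- a) \<bullet> x = 0}"
    then have "minimizers S (- a) = S" by (intro minimizers_eq_self) auto
    then show False using F_eq \<open>F \<noteq> convex hull S\<close> by simp
  qed
  ultimately show ?thesis by blast
qed

text \<open>The face of the Minkowski sum selected by \<open>w\<close> is an edge with direction
  \<open>a - b\<close>. Functionals in its normal cone are constant along the edge. Conversely, a
  small shift of \<open>w\<close> orthogonal to the edge changes no component and stays in the cone.
  So the cone spans the hyperplane orthogonal to \<open>a - b\<close>, which contains
  \<open>v\<close>.\<close>

lemma edge_normal_in_arrangement:
  fixes A :: "nat \<Rightarrow> 'a::euclidean_space set"
  assumes fin: "\<And>j. j \<le> DIM('a) \<Longrightarrow> finite (A j)"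
    and ne: "\<And>j. j \<le> DIM('a) \<Longrightarrow> A j \<noteq> {}"
    and j: "j \<le> DIM('a)" and ab: "a \<in> minimizers (A j) w" "b \<in> minimizers (A j) w" "a \<noteq> b"
    and edge: "\<And>k. k \<le> DIM('a) \<Longrightarrow> directions (minimizers (A k) w) \<subseteq> span {a - b}"
    and v: "v \<bullet> (a - b) = 0"
  shows "v \<in> hyperplane_arrangement (newton_sum A)"
proof -
  define e where "e = a - b"
  define F where "F = minimizers (newton_sum A) w"
  define \<sigma> where "\<sigma> = inner_normal_cone (newton_sum A) F"
  have Fsum: "F = (\<Sum>k\<le>DIM('a). convex hull (minimizers (A k) w))"
    unfolding F_def using minimizers_newton_sum[OF fin] by (simp add: cell_sum_def)
  have "\<exists>c. \<forall>k\<in>{..DIM('a)}. c k \<in> minimizers (A k) w"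
    by (rule bchoice) (use minimizers_nonempty[OF fin ne] in blast)
  then obtain c where c: "\<And>k. k \<le> DIM('a) \<Longrightarrow> c k \<in> minimizers (A k) w" by auto
  \<comment> \<open>Fixing all summands but the \<open>j\<close>-th gives two points of the face
    that differ by exactly \<open>a - b\<close>.\<close>
  have in_F: "(\<Sum>k\<le>DIM('a). (c(j := x)) k) \<in> F" if "x \<in> minimizers (A j) w" for x
    unfolding Fsum set_sum_alt[OF finite_atMost] using c that by (auto intro!: hull_inc)
  have sum_split: "(\<Sum>k\<le>DIM('a). (c(j := x)) k) = x + (\<Sum>k\<in>{..DIM('a)} - {j}. c k)" for x
    using j by (subst sum.remove[of _ j]) (auto intro!: sum.cong)
  have Fne: "F \<noteq> {}" using in_F ab(1) by blast
  have "convex (newton_sum A)"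
    unfolding newton_sum_def cell_sum_def by (intro convex_set_sum convex_convex_hull)
  then have "F face_of newton_sum A"
  proof -
    obtain f where f: "f \<in> F" using Fne by auto
    have "F = newton_sum A \<inter> {x. w \<bullet> x = w \<bullet> f}"
      using f by (auto simp: F_def minimizers_def intro: antisym)
    moreover have "w \<bullet> f \<le> w \<bullet> x" if "x \<in> newton_sum A" for x
      using f that by (simp add: F_def minimizers_def)
    ultimately show ?thesis
      using face_of_Int_supporting_hyperplane_ge[OF \<open>convex (newton_sum A)\<close>] by metis
  qed
  then have fan: "\<sigma> \<in> normal_fan (newton_sum A)"
    using Fne by (auto simp: normal_fan_def \<sigma>_def)
  have \<sigma>_iff: "u \<in> \<sigma> \<longleftrightarrow> F \<subseteq> minimizers (newton_sum A) u" for u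
    unfolding \<sigma>_def inner_normal_cone_def F_def minimizers_def by auto
  have sub1: "\<sigma> \<subseteq> {u. e \<bullet> u = 0}"
  proof
    fix u assume "u \<in> \<sigma>"
    then have "u \<bullet> (\<Sum>k\<le>DIM('a). (c(j := a)) k) = u \<bullet> (\<Sum>k\<le>DIM('a). (c(j := b)) k)"
      using in_F ab(1,2) minimizers_mono_eq \<sigma>_iff by blast
    then show "u \<in> {u. e \<bullet> u = 0}"
      unfolding sum_split by (simp add: e_def inner_add_right inner_diff_right inner_commute)
  qed
  have sub2: "{u. e \<bullet> u = 0} \<subseteq> span \<sigma>"
  proof
    fix u assume "u \<in> {u. e \<bullet> u = 0}"
    then have ue: "e \<bullet> u = 0" by simp
    obtain \<epsilon> where \<epsilon>: "\<epsilon> > 0" "\<And>z k. norm z < \<epsilon> \<Longrightarrow> k \<le> DIM('a) \<Longrightarrow>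
        minimizers (A k) (w + z) = minimizers (minimizers (A k) w) z"
      using minimizers_perturb_family[of "DIM('a)" A w] fin by blast
    \<comment> \<open>The summand \<open>1\<close> keeps the quotient defined for
      \<open>u = 0\<close> and makes the norm bound strict.\<close>
    define t where "t = \<epsilon> / (norm u + 1)"
    have pos: "norm u + 1 > 0" by (simp add: add_nonneg_pos)
    then have t: "t > 0" using \<epsilon>(1) by (simp add: t_def)
    have "norm (t *\<^sub>R u) = \<epsilon> * (norm u / (norm u + 1))"
      using pos \<epsilon>(1) by (simp add: t_def)
    also have "\<dots> < \<epsilon> * 1" using \<epsilon>(1) pos by (intro mult_strict_left_mono) simp_all
    finally have "norm (t *\<^sub>R u) < \<epsilon>" by simp
    moreover have "minimizers (minimizers (A k) w) (t *\<^sub>R u) = minimizers (A k) w" if k: "k \<le> DIM('a)" for k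
    proof (rule minimizers_eq_self)
      fix x assume "x \<in> directions (minimizers (A k) w)"
      then obtain r where "x = r *\<^sub>R e" using edge[OF k] unfolding e_def span_singleton by auto
      then show "(t *\<^sub>R u) \<bullet> x = 0" using ue by (simp add: inner_commute)
    qed
    ultimately have "minimizers (A k) (w + t *\<^sub>R u) = minimizers (A k) w" if "k \<le> DIM('a)" for k
      using \<epsilon>(2) that by simp
    then have "minimizers (newton_sum A) (w + t *\<^sub>R u) = F"
      unfolding Fsum using minimizers_newton_sum[OF fin] by (simp add: cell_sum_def)
    then have "w + t *\<^sub>R u \<in> \<sigma>" "w \<in> \<sigma>" by (simp_all add: \<sigma>_iff F_def)
    \<comment> \<open>Both \<open>w\<close> and its shift lie in the cone, so their rescaled
      difference \<open>u\<close> lies in its span.\<close>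
    then have "(1 / t) *\<^sub>R ((w + t *\<^sub>R u) - w) \<in> span \<sigma>"
      by (intro span_scale span_diff[OF span_base span_base])
    then show "u \<in> span \<sigma>" using t by simp
  qed
  have "span \<sigma> \<subseteq> {u. e \<bullet> u = 0}"
    using sub1 by (intro span_minimal subspace_inner_eq_0)
  with sub2 have span: "span \<sigma> = {u. e \<bullet> u = 0}" by blast
  have "0 \<in> \<sigma>" by (simp add: \<sigma>_def inner_normal_cone_def)
  then have "aff_dim \<sigma> = int (dim \<sigma>)" by (intro aff_dim_zero hull_inc)
  also have "dim \<sigma> = DIM('a) - 1"
    using dim_hyperplane[of e] ab(3) span dim_span[of \<sigma>] by (simp add: e_def)
  finally have "aff_dim \<sigma> = int DIM('a) - 1"
    using DIM_positive[where 'a='a] by (simp add: of_nat_diff)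
  moreover have "v \<in> span \<sigma>" using v by (simp add: span e_def inner_commute)
  ultimately show ?thesis unfolding hyperplane_arrangement_def using fan by blast
qed

text \<open>Induction on the dimension spanned by the direction spaces of all component faces.
  Perturbing \<open>w\<close> shrinks that span while the face of \<open>A j\<close> remains
  nontrivial, and \<open>v\<close> remains constant on the smaller face. The descent ends when all
  faces are parallel to one segment, an edge to which \<open>edge_normal_in_arrangement\<close>
  applies.\<close>

lemma constant_face_in_arrangement:
  fixes A :: "nat \<Rightarrow> 'a::euclidean_space set"
  assumes fin: "\<And>j. j \<le> DIM('a) \<Longrightarrow> finite (A j)"
    and ne: "\<And>j. j \<le> DIM('a) \<Longrightarrow> A j \<noteq> {}"
    and j: "j \<le> DIM('a)"
    and "directions (minimizers (A j) w) \<noteq> {0}"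
    and "directions (minimizers (A j) w) \<subseteq> {x. v \<bullet> x = 0}"
  shows "v \<in> hyperplane_arrangement (newton_sum A)"
  using assms(4,5)
proof (induction "dim (\<Union>k\<le>DIM('a). directions (minimizers (A k) w))" arbitrary: w rule: less_induct)
  case less
  define V where "V w = (\<Union>k\<le>DIM('a). directions (minimizers (A k) w))" for w
  let ?M = "\<lambda>k. minimizers (A k) w"
  \<comment> \<open>After a small perturbation along \<open>z\<close> all direction spaces lie in
    the orthogonal complement of \<open>z\<close>. As \<open>V w\<close> does not, the span drops
    strictly.\<close>
  have step: ?thesis if z: "directions (minimizers (?M j) z) \<noteq> {0}" "\<not> V w \<subseteq> {x. z \<bullet> x = 0}" for z
  proof -
    obtain \<epsilon> where \<epsilon>: "\<epsilon> > 0" "\<And>z k. norm z < \<epsilon> \<Longrightarrow> k \<le> DIM('a) \<Longrightarrow>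
        minimizers (A k) (w + z) = minimizers (minimizers (A k) w) z"
      using minimizers_perturb_family[of "DIM('a)" A w] fin by blast
    have "z \<noteq> 0" using z(2) by auto
    define t where "t = \<epsilon> / norm z / 2"
    have t: "t > 0" "norm (t *\<^sub>R z) < \<epsilon>" using \<epsilon>(1) \<open>z \<noteq> 0\<close> by (auto simp: t_def)
    define w' where "w' = w + t *\<^sub>R z"
    have min: "minimizers (A k) w' = minimizers (?M k) z" if "k \<le> DIM('a)" for k
      using \<epsilon>(2)[OF t(2) that] t(1) by (simp add: w'_def minimizers_scaleR)
    have sub: "V w' \<subseteq> V w" "V w' \<subseteq> {x. z \<bullet> x = 0}"
      using min directions_minimizers_subset minimizers_orthogonal unfolding V_def by fastforce+
    have "span (V w') \<subseteq> {x. z \<bullet> x = 0}"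
      using sub(2) by (intro span_minimal subspace_inner_eq_0)
    then have "span (V w') \<noteq> span (V w)" using z(2) span_superset[of "V w"] by auto
    then have "span (V w') \<subset> span (V w)" using span_mono[OF sub(1)] by blast
    then have "dim (V w') < dim (V w)" by (rule dim_psubset)
    then show ?thesis
      using less.hyps[of w'] less.prems z(1) min[OF j] directions_minimizers_subset[of "?M j" z]
      unfolding V_def by auto
  qed
  have finM: "finite (?M j)" using fin[OF j] by (simp add: minimizers_def)
  have subV: "directions (?M j) \<subseteq> V w" using j by (auto simp: V_def)
  consider "2 \<le> dim (directions (?M j))" | "span (V w) \<noteq> directions (?M j)"
    | "dim (directions (?M j)) \<le> 1" "span (V w) = directions (?M j)" by linarith
  then show ?case
  proof cases
    case 1
    then show ?thesis using exists_minimizers_edge[OF finM] step subV by blast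
  next
    case 2
    \<comment> \<open>A nonzero \<open>z\<close> in \<open>span (V w)\<close> orthogonal to the face
      of \<open>A j\<close> leaves that face unchanged but cuts down some other component.\<close>
    have "directions (?M j) \<subseteq> span (V w)" using subV span_superset by blast
    with 2 have "span (directions (?M j)) \<subset> span (V w)"
      by (metis psubsetI span_eq_iff subspace_directions)
    then obtain z where z: "z \<noteq> 0" "z \<in> span (V w)" "\<And>y. y \<in> span (directions (?M j)) \<Longrightarrow> orthogonal z y"
      using orthogonal_to_subspace_exists_gen by blast
    have "\<not> V w \<subseteq> {x. z \<bullet> x = 0}"
    proof
      assume "V w \<subseteq> {x. z \<bullet> x = 0}"
      then have "span (V w) \<subseteq> {x. z \<bullet> x = 0}" by (intro span_minimal subspace_inner_eq_0)
      then show False using z(1,2) by auto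
    qed
    moreover have "minimizers (?M j) z = ?M j"
      using z(3) by (intro minimizers_eq_self) (auto simp: orthogonal_def span_base)
    ultimately show ?thesis using step less.prems(1) by metis
  next
    case 3
    have "?M j \<noteq> {}" using minimizers_nonempty[OF fin ne] j by blast
    then obtain a b where ab: "a \<in> ?M j" "b \<in> ?M j" "a \<noteq> b"
      using less.prems(1) directions_eq_0_iff[of "?M j"] by blast
    \<comment> \<open>What remains is a single line, spanned by \<open>a - b\<close>, containing the
      direction spaces of all components.\<close>
    have "{a - b} \<subseteq> directions (?M j)" using ab by (simp add: directions_diff)
    moreover have "dim {a - b} = 1" using ab by simp
    ultimately have "span {a - b} = span (directions (?M j))"
      using 3(1) by (intro dim_eq_span) (auto)
    then have eq: "span {a - b} = directions (?M j)" by (simp add: span_eq_iff[THEN iffD2, OF subspace_directions])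
    show ?thesis
    proof (rule edge_normal_in_arrangement[where A = A and w = w, OF _ _ j ab])
      show "directions (?M k) \<subseteq> span {a - b}" if "k \<le> DIM('a)" for k
        using 3(2) eq that span_superset[of "V w"] by (auto simp: V_def)
      show "v \<bullet> (a - b) = 0" using less.prems(2) directions_diff[OF ab(1,2)] by auto
    qed (use fin ne in auto)
  qed
qed


section \<open>Refinement under small liftings\<close>

text \<open>
  By Farkas' lemma a combination of the constraints at \<open>t = 0\<close> with nonnegative coefficients is
  contradictory, and the same combination stays contradictory for small \<open>t\<close>.
\<close>

lemma infeasible_system_stable:
  fixes K :: "('a::euclidean_space \<times> real \<times> real) set"
  assumes "finite K" and infeasible: "\<not> (\<exists>u. \<forall>(d, s, r)\<in>K. u \<bullet> d \<le> r)"
  shows "\<exists>\<epsilon>>0. \<forall>t u. \<bar>t\<bar> < \<epsilon> \<longrightarrow> \<not> (\<forall>(d, s, r)\<in>K. u \<bullet> d + t * s \<le> r)"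
proof -
  \<comment> \<open>The added generator is the valid inequality \<open>0 \<le> 1\<close>. The map
    \<open>\<pi>\<close> forgets the coefficients of \<open>t\<close>, giving the system at
    \<open>t = 0\<close>.\<close>
  define G where "G = insert (0, 0, 1) K"
  define \<pi> :: "'a \<times> real \<times> real \<Rightarrow> 'a \<times> real" where "\<pi> = (\<lambda>x. (fst x, snd (snd x)))"
  let ?C = "convex_cone hull (\<pi> ` G)"
  have lin: "linear \<pi>" by (intro linearI) (simp_all add: \<pi>_def)
  have "(0, -1) \<in> ?C"
  proof (rule ccontr)
    assume "(0, -1) \<notin> ?C"
    moreover have "closed ?C" using assms(1) by (intro closed_convex_cone_hull) (simp add: G_def)
    ultimately obtain a b where ab: "a \<bullet> (0, -1) < b" "\<And>x. x \<in> ?C \<Longrightarrow> a \<bullet> x > b"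
      using separating_hyperplane_closed_point[OF convex_convex_cone_hull] by metis
    have "b < 0" using ab(2)[OF convex_cone_hull_contains_0] by simp
    have nonneg: "a \<bullet> x \<ge> 0" if x: "x \<in> ?C" for x
    proof (rule ccontr)
      assume neg: "\<not> a \<bullet> x \<ge> 0"
      have "(b / (a \<bullet> x)) *\<^sub>R x \<in> ?C"
        using x neg \<open>b < 0\<close> by (intro convex_cone_hull_mul) (auto simp: divide_nonpos_nonpos)
      then have "b < a \<bullet> ((b / (a \<bullet> x)) *\<^sub>R x)" by (rule ab(2))
      moreover have "a \<bullet> ((b / (a \<bullet> x)) *\<^sub>R x) = b" using neg by simp
      ultimately show False by simp
    qed
    obtain u s where a: "a = (u, s)" by fastforce
    have "s > 0" using ab(1) \<open>b < 0\<close> a by simp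
    \<comment> \<open>Scaling the separating functional to \<open>1\<close> in the last coordinate
      and changing sign would give a solution of the system at \<open>t = 0\<close>.\<close>
    have "(- (1 / s) *\<^sub>R u) \<bullet> d \<le> r" if "(d, s', r) \<in> K" for d s' r
    proof -
      have "(d, r) \<in> ?C" using that by (intro hull_inc) (force simp: G_def \<pi>_def)
      then have "u \<bullet> d + s * r \<ge> 0" using nonneg a by fastforce
      then show ?thesis using \<open>s > 0\<close> by (simp add: field_simps)
    qed
    then show False using infeasible by blast
  qed
  then obtain g where g: "g \<in> convex_cone hull G" "\<pi> g = (0, -1)"
    using convex_cone_hull_linear_image[OF lin, of G] by (metis imageE)
  then obtain s where s: "(0, s, -1) \<in> convex_cone hull G"
    by (cases g) (auto simp: \<pi>_def)
  \<comment> \<open>With its \<open>t\<close>-coefficient \<open>s\<close> restored, the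
    contradictory combination reads \<open>t * s \<le> -1\<close>, which fails for \<open>t\<close>
    of this size. The summand \<open>1\<close> covers \<open>s = 0\<close>.\<close>
  show ?thesis
  proof (intro exI[of _ "1 / (\<bar>s\<bar> + 1)"] conjI allI impI notI)
    fix t :: real and u :: 'a
    assume t: "\<bar>t\<bar> < 1 / (\<bar>s\<bar> + 1)" and feasible: "\<forall>(d, s, r)\<in>K. u \<bullet> d + t * s \<le> r"
    have "convex_cone hull G \<subseteq> {x. (- u, - t, 1) \<bullet> x \<ge> 0}"
      using feasible by (intro hull_minimal convex_cone_halfspace_ge) (auto simp: G_def)
    then have "(- u, - t, 1) \<bullet> (0 :: 'a, s, - 1 :: real) \<ge> 0" using s by blast
    then have "1 \<le> \<bar>t\<bar> * \<bar>s\<bar>"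
      using abs_ge_self[of "- (t * s)"] by (simp add: abs_mult)
    also have "\<dots> \<le> \<bar>t\<bar> * (\<bar>s\<bar> + 1)" by (intro mult_left_mono) auto
    also have "\<dots> < 1" using t by (simp add: field_simps)
    finally show False by simp
  qed (simp add: add_nonneg_pos)
qed

text \<open>That \<open>u\<close> selects faces containing prescribed subsets \<open>T j\<close> is
  a finite linear system in \<open>u\<close> in which \<open>t\<close> enters linearly. There are
  finitely many families \<open>T\<close>, and each one infeasible at \<open>t = 0\<close> stays
  infeasible for small \<open>t\<close>. Hence a family selected at small \<open>t\<close> is
  contained in one selected at \<open>0\<close>.\<close>

lemma minimizers_refine:
  fixes A :: "nat \<Rightarrow> 'a::euclidean_space set"
  assumes fin: "\<And>j. j \<le> n \<Longrightarrow> finite (A j)"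
  shows "\<exists>\<epsilon>>0. \<forall>t u'. \<bar>t\<bar> < \<epsilon> \<longrightarrow> (\<exists>u. \<forall>j\<le>n.
    minimizers (A j) (u' + (\<mu>(i := t)) j *\<^sub>R v) \<subseteq> minimizers (A j) (u + (\<mu>(i := 0)) j *\<^sub>R v))"
proof -
  \<comment> \<open>The triple \<open>(d, s, r)\<close> encodes
    \<open>u \<bullet> d + t * s \<le> r\<close>, which says that \<open>a\<close> is no worse than
    \<open>b\<close> in the \<open>j\<close>-th support. Only for \<open>j = i\<close> does the
    lifting contribute to the coefficient of \<open>t\<close>; otherwise it goes into the
    bound.\<close>
  define f where "f j a b = (a - b, if j = i then v \<bullet> (a - b) else 0,
      if j = i then 0 else - (\<mu> j * (v \<bullet> (a - b))))" for j and a b :: 'a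
  define K where "K T = (\<Union>j\<le>n. \<Union>a\<in>T j. f j a ` A j)" for T :: "nat \<Rightarrow> 'a set"
  define \<T> where "\<T> = PiE {..n} (\<lambda>j. Pow (A j))"
  have K_iff: "(\<forall>(d, s, r)\<in>K T. u \<bullet> d + t * s \<le> r) \<longleftrightarrow>
      (\<forall>j\<le>n. T j \<subseteq> minimizers (A j) (u + (\<mu>(i := t)) j *\<^sub>R v))"
    if "T \<in> \<T>" for T t u
  proof -
    have sub: "\<forall>j\<le>n. T j \<subseteq> A j" using \<open>T \<in> \<T>\<close> by (auto simp: \<T>_def PiE_def)
    have f_iff: "(case f j a b of (d, s, r) \<Rightarrow> u \<bullet> d + t * s \<le> r) \<longleftrightarrow>
      (u + (\<mu>(i := t)) j *\<^sub>R v) \<bullet> a \<le> (u + (\<mu>(i := t)) j *\<^sub>R v) \<bullet> b" for j a b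
      by (simp add: f_def inner_add_left inner_diff_right algebra_simps)
    have "(\<forall>(d, s, r)\<in>K T. u \<bullet> d + t * s \<le> r) \<longleftrightarrow> (\<forall>j\<le>n. \<forall>a\<in>T j. \<forall>b\<in>A j.
        (u + (\<mu>(i := t)) j *\<^sub>R v) \<bullet> a \<le> (u + (\<mu>(i := t)) j *\<^sub>R v) \<bullet> b)"
      unfolding K_def by (simp add: f_iff Ball_def[of "{..n}"] del: fun_upd_apply)
    then show ?thesis using sub unfolding minimizers_def by blast
  qed
  have finT: "finite \<T>" unfolding \<T>_def using fin by (intro finite_PiE) auto
  define feasible where "feasible T \<longleftrightarrow> (\<exists>u. \<forall>(d, s, r)\<in>K T. u \<bullet> d \<le> r)" for T
  have "\<exists>\<epsilon>>0. \<forall>t u. \<bar>t\<bar> < \<epsilon> \<longrightarrow> (\<forall>(d, s, r)\<in>K T. u \<bullet> d + t * s \<le> r) \<longrightarrow> feasible T"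
    if "T \<in> \<T>" for T
  proof (cases "feasible T")
    case True
    then show ?thesis by (intro exI[of _ "1::real"]) simp
  next
    case False
    have "finite (T j)" if "j \<le> n" for j
      using \<open>T \<in> \<T>\<close> fin[OF that] that by (auto simp: \<T>_def PiE_def Pi_def intro: finite_subset)
    then have "finite (K T)" using fin by (auto simp: K_def)
    from infeasible_system_stable[OF this False[unfolded feasible_def]] show ?thesis
      by (elim exE conjE) (rule exI, rule conjI, assumption, intro allI impI, elim allE, erule (1) impE, erule (1) notE)
  qed
  then have "\<forall>T\<in>\<T>. \<exists>\<epsilon>. \<epsilon> > 0 \<and>
      (\<forall>t u. \<bar>t\<bar> < \<epsilon> \<longrightarrow> (\<forall>(d, s, r)\<in>K T. u \<bullet> d + t * s \<le> r) \<longrightarrow> feasible T)" by blast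
  from bchoice[OF this] obtain e where e: "\<forall>T\<in>\<T>. e T > 0 \<and>
      (\<forall>t u. \<bar>t\<bar> < e T \<longrightarrow> (\<forall>(d, s, r)\<in>K T. u \<bullet> d + t * s \<le> r) \<longrightarrow> feasible T)"
    by (elim exE)
  define \<epsilon> where "\<epsilon> = Min (insert 1 (e ` \<T>))"
  have \<epsilon>: "\<epsilon> > 0" using finT e by (auto simp: \<epsilon>_def)
  have \<epsilon>_le: "\<epsilon> \<le> e T" if "T \<in> \<T>" for T using finT that unfolding \<epsilon>_def by (intro Min_le) auto
  show ?thesis
  proof (intro exI[of _ \<epsilon>] conjI allI impI)
    fix t u' assume t: "\<bar>t\<bar> < \<epsilon>"
    \<comment> \<open>The faces selected by \<open>u'\<close> form a family for which
      \<open>u'\<close> itself solves the system at \<open>t\<close>.\<close>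
    define T where "T = restrict (\<lambda>j. minimizers (A j) (u' + (\<mu>(i := t)) j *\<^sub>R v)) {..n}"
    have T: "T \<in> \<T>" by (auto simp: T_def \<T>_def minimizers_def)
    have "\<forall>(d, s, r)\<in>K T. u' \<bullet> d + t * s \<le> r"
      unfolding K_iff[OF T] by (simp add: T_def)
    moreover have "\<bar>t\<bar> < e T" using t \<epsilon>_le[OF T] by simp
    ultimately have "feasible T" using e T by blast
    then obtain u where "\<forall>(d, s, r)\<in>K T. u \<bullet> d \<le> r" unfolding feasible_def ..
    then have "\<forall>(d, s, r)\<in>K T. u \<bullet> d + 0 * s \<le> r" by simp
    then have "\<forall>j\<le>n. T j \<subseteq> minimizers (A j) (u + (\<mu>(i := 0)) j *\<^sub>R v)"
      unfolding K_iff[OF T] .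
    then show "\<exists>u. \<forall>j\<le>n. minimizers (A j) (u' + (\<mu>(i := t)) j *\<^sub>R v)
        \<subseteq> minimizers (A j) (u + (\<mu>(i := 0)) j *\<^sub>R v)"
      by (intro exI[of _ u]) (simp add: T_def del: fun_upd_apply)
  qed (use \<epsilon> in auto)
qed


section \<open>Relations between direction spaces\<close>

text \<open>For each family \<open>U\<close> and index \<open>k\<close> one relation with first
  nonzero pairing at \<open>k\<close> is fixed, if there is any, and \<open>M\<close> bounds the
  ratios of its later pairings to the first. The weighted sum vanishes on every relation, so an
  offending one may be replaced by the fixed one, where the \<open>k\<close>-th term outweighs all
  later terms. Thus \<open>M\<close> depends on the finite stock of spaces but not on
  \<open>\<mu>\<close>.\<close>

lemma relation_threshold:
  fixes v :: "'a::real_inner" and \<V> :: "'a set set" and n :: nat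
  assumes fin: "finite \<V>"
  shows "\<exists>M\<ge>0. \<forall>U \<mu> m. (\<forall>j\<le>n. U j \<in> \<V>) \<longrightarrow>
    (\<forall>k<m. k \<le> n \<longrightarrow> M * (\<Sum>j\<in>{k<..n}. \<bar>\<mu> j\<bar>) < \<mu> k) \<longrightarrow>
    (\<forall>x. (\<forall>j\<le>n. x j \<in> U j) \<longrightarrow> (\<Sum>j\<le>n. x j) = 0 \<longrightarrow> (\<Sum>j\<le>n. \<mu> j * (v \<bullet> x j)) = 0) \<longrightarrow>
    (\<forall>x. (\<forall>j\<le>n. x j \<in> U j) \<longrightarrow> (\<Sum>j\<le>n. x j) = 0 \<longrightarrow> (\<forall>j<m. j \<le> n \<longrightarrow> v \<bullet> x j = 0))"
proof -
  define lead where "lead U k x \<longleftrightarrow> (\<forall>j\<le>n. x j \<in> U j) \<and> (\<Sum>j\<le>n. x j) = 0 \<and>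
    v \<bullet> x k \<noteq> 0 \<and> (\<forall>j<k. v \<bullet> x j = 0)" for U :: "nat \<Rightarrow> 'a set" and k x
  define good where "good p M \<longleftrightarrow> (\<forall>x. lead (fst p) (snd p) x \<longrightarrow>
    (\<exists>x. lead (fst p) (snd p) x \<and> (\<forall>j\<le>n. \<bar>v \<bullet> x j\<bar> \<le> M * \<bar>v \<bullet> x (snd p)\<bar>)))" for p M
  define I where "I = PiE {..n} (\<lambda>_. \<V>) \<times> {..n}"
  have "finite I" using fin by (auto simp: I_def intro: finite_PiE)
  have "\<exists>M. 0 \<le> M \<and> good p M" for p
  proof (cases "\<exists>x. lead (fst p) (snd p) x")
    case False
    then show ?thesis by (auto simp: good_def intro!: exI[of _ "0::real"])
  next
    case True
    then obtain x where x: "lead (fst p) (snd p) x" ..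
    define M where "M = (\<Sum>j\<le>n. \<bar>v \<bullet> x j\<bar> / \<bar>v \<bullet> x (snd p)\<bar>)"
    have "\<bar>v \<bullet> x j\<bar> \<le> M * \<bar>v \<bullet> x (snd p)\<bar>" if "j \<le> n" for j
    proof -
      have "\<bar>v \<bullet> x j\<bar> / \<bar>v \<bullet> x (snd p)\<bar> \<le> M"
        unfolding M_def using that by (intro member_le_sum) auto
      then show ?thesis using x by (simp add: lead_def field_simps)
    qed
    moreover have "0 \<le> M" unfolding M_def by (intro sum_nonneg) simp
    ultimately show ?thesis using x unfolding good_def by blast
  qed
  then have "\<forall>p. \<exists>M. 0 \<le> M \<and> good p M" ..
  from choice[OF this] obtain N where N: "\<And>p. 0 \<le> N p" "\<And>p. good p (N p)" by blast
  \<comment> \<open>A sum of nonnegative bounds dominates each of them.\<close>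
  define M where "M = (\<Sum>p\<in>I. N p)"
  have M_ge: "N p \<le> M" if "p \<in> I" for p
    unfolding M_def using \<open>finite I\<close> that N(1) by (intro member_le_sum) auto
  show ?thesis
  proof (intro exI[of _ M] conjI allI impI)
    show "0 \<le> M" unfolding M_def using N(1) by (intro sum_nonneg) simp
  next
    fix U \<mu> m x j
    assume U: "\<forall>j\<le>n. U j \<in> \<V>"
      and \<mu>: "\<forall>k<m. k \<le> n \<longrightarrow> M * (\<Sum>j\<in>{k<..n}. \<bar>\<mu> j\<bar>) < \<mu> k"
      and rel: "\<forall>x. (\<forall>j\<le>n. x j \<in> U j) \<longrightarrow> (\<Sum>j\<le>n. x j) = 0 \<longrightarrow> (\<Sum>j\<le>n. \<mu> j * (v \<bullet> x j)) = 0"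
      and x: "\<forall>j\<le>n. x j \<in> U j" "(\<Sum>j\<le>n. x j) = 0" and j: "j < m" "j \<le> n"
    show "v \<bullet> x j = 0"
    proof (rule ccontr)
      assume "v \<bullet> x j \<noteq> 0"
      define k where "k = (LEAST j. v \<bullet> x j \<noteq> 0)"
      have k: "v \<bullet> x k \<noteq> 0" unfolding k_def by (rule LeastI) fact
      have "k \<le> j" unfolding k_def by (rule Least_le) fact
      have "v \<bullet> x l = 0" if "l < k" for l using not_less_Least that unfolding k_def by blast
      \<comment> \<open>Restricting \<open>U\<close> to the relevant indices puts the pair into the
        finite set \<open>I\<close>.\<close>
      then have "lead (restrict U {..n}) k x" using x k by (simp add: lead_def)
      moreover have p: "(restrict U {..n}, k) \<in> I" using U j \<open>k \<le> j\<close> by (auto simp: I_def)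
      ultimately obtain y where y: "lead (restrict U {..n}) k y"
        "\<forall>j\<le>n. \<bar>v \<bullet> y j\<bar> \<le> N (restrict U {..n}, k) * \<bar>v \<bullet> y k\<bar>"
        using N(2)[of "(restrict U {..n}, k)"] unfolding good_def by auto
      have y_le: "\<bar>v \<bullet> y j\<bar> \<le> M * \<bar>v \<bullet> y k\<bar>" if "j \<le> n" for j
        using y(2) that mult_right_mono[OF M_ge[OF p], of "\<bar>v \<bullet> y k\<bar>"] by fastforce
      have yk: "v \<bullet> y k \<noteq> 0" "\<And>l. l < k \<Longrightarrow> v \<bullet> y l = 0" using y(1) by (auto simp: lead_def)
      have kn: "k \<le> n" "k < m" using \<open>k \<le> j\<close> j by auto
      have "0 = (\<Sum>j\<le>n. \<mu> j * (v \<bullet> y j))" using rel y(1) by (simp add: lead_def)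
      also have "\<dots> = (\<Sum>j\<in>{k..n}. \<mu> j * (v \<bullet> y j))"
        using yk(2) by (intro sum.mono_neutral_right) force+
      also have "\<dots> = \<mu> k * (v \<bullet> y k) + (\<Sum>j\<in>{k<..n}. \<mu> j * (v \<bullet> y j))"
        using kn(1) by (simp add: sum.head)
      finally have "\<bar>\<mu> k * (v \<bullet> y k)\<bar> = \<bar>\<Sum>j\<in>{k<..n}. \<mu> j * (v \<bullet> y j)\<bar>" by linarith
      also have "\<dots> \<le> (\<Sum>j\<in>{k<..n}. \<bar>\<mu> j * (v \<bullet> y j)\<bar>)" by (rule sum_abs)
      also have "\<dots> \<le> (\<Sum>j\<in>{k<..n}. \<bar>\<mu> j\<bar> * (M * \<bar>v \<bullet> y k\<bar>))"
        using y_le by (intro sum_mono) (simp add: abs_mult mult_left_mono)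
      also have "\<dots> = (M * (\<Sum>j\<in>{k<..n}. \<bar>\<mu> j\<bar>)) * \<bar>v \<bullet> y k\<bar>"
        unfolding sum_distrib_right[symmetric] by (simp add: mult_ac)
      also have "\<dots> < \<mu> k * \<bar>v \<bullet> y k\<bar>"
        using \<mu> kn yk(1) by (intro mult_strict_right_mono) auto
      also have "\<dots> \<le> \<bar>\<mu> k * (v \<bullet> y k)\<bar>" by (simp add: abs_mult mult_right_mono)
      finally show False by simp
    qed
  qed
qed

text \<open>\<open>C\<close> and \<open>D\<close> stand for the direction spaces of a cell of the
  finest subdivision and of a coarser cell around it; \<open>KC\<close> and \<open>KD\<close> come
  from \<open>relation_threshold\<close>. The chosen vectors are \<open>DIM('a)\<close> in number,
  and relations in \<open>D\<close> control coordinates below \<open>i\<close>, relations in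
  \<open>C\<close> the remaining ones.\<close>

lemma mixed_dimensions:
  fixes C D :: "nat \<Rightarrow> 'a::euclidean_space set"
  assumes C: "\<And>j. j \<le> DIM('a) \<Longrightarrow> subspace (C j)" and D: "\<And>j. j \<le> DIM('a) \<Longrightarrow> subspace (D j)"
    and CD: "\<And>j. j \<le> DIM('a) \<Longrightarrow> C j \<subseteq> D j"
    and KD: "\<And>x j. \<forall>j\<le>DIM('a). x j \<in> D j \<Longrightarrow> (\<Sum>j\<le>DIM('a). x j) = 0 \<Longrightarrow> j < i \<Longrightarrow> v \<bullet> x j = 0"
    and KC: "\<And>x j. \<forall>j\<le>DIM('a). x j \<in> C j \<Longrightarrow> (\<Sum>j\<le>DIM('a). x j) = 0 \<Longrightarrow> j \<le> DIM('a) \<Longrightarrow> v \<bullet> x j = 0"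
    and full: "\<And>P. subspace P \<Longrightarrow> (\<And>j. j \<le> DIM('a) \<Longrightarrow> C j \<subseteq> P) \<Longrightarrow> P = UNIV"
    and i: "i \<le> DIM('a)"
    and eC: "\<And>j. i < j \<Longrightarrow> j \<le> DIM('a) \<Longrightarrow> \<exists>x\<in>C j. v \<bullet> x \<noteq> 0"
    and eD: "\<And>j. j < i \<Longrightarrow> \<exists>x\<in>D j. v \<bullet> x \<noteq> 0"
    and j: "j \<le> DIM('a)" "j \<noteq> i"
  shows "dim (C j) = 1"
proof -
  let ?n = "DIM('a)"
  define I where "I = {..?n} - {i}"
  have finI: "finite I" and cardI: "card I = ?n" using i by (auto simp: I_def)
  have "\<forall>j. \<exists>x. j \<in> I \<longrightarrow> v \<bullet> x \<noteq> 0 \<and> x \<in> D j \<and> (i < j \<longrightarrow> x \<in> C j)"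
  proof
    fix j show "\<exists>x. j \<in> I \<longrightarrow> v \<bullet> x \<noteq> 0 \<and> x \<in> D j \<and> (i < j \<longrightarrow> x \<in> C j)"
      using eC[of j] eD[of j] CD[of j] by (cases "i < j") (auto simp: I_def)
  qed
  from choice[OF this] obtain e where e: "\<And>j. j \<in> I \<Longrightarrow> v \<bullet> e j \<noteq> 0" "\<And>j. j \<in> I \<Longrightarrow> e j \<in> D j"
    "\<And>j. j \<in> I \<Longrightarrow> i < j \<Longrightarrow> e j \<in> C j" by blast
  have sumI: "(\<Sum>k\<le>?n. if k = i then 0 else f k) = (\<Sum>k\<in>I. f k)" for f :: "nat \<Rightarrow> 'a"
    unfolding I_def by (rule sum.mono_neutral_cong_right) auto
  \<comment> \<open>First \<open>KD\<close> removes the coefficients below \<open>i\<close>; what is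
    left is a relation inside \<open>C\<close>, to which \<open>KC\<close> applies.\<close>
  have indep: "c k = 0" if c: "(\<Sum>k\<in>I. c k *\<^sub>R e k) = 0" and k: "k \<in> I" for c k
  proof -
    have lt: "c l = 0" if "l < i" for l
    proof -
      have "v \<bullet> (if l = i then 0 else c l *\<^sub>R e l) = 0"
        by (rule KD[OF _ _ that]) (use e(2) D c in \<open>auto simp: sumI I_def subspace_0 subspace_scale\<close>)
      then show ?thesis using that i e(1)[of l] by (auto simp: I_def)
    qed
    have "v \<bullet> (if k = i then 0 else if k < i then 0 else c k *\<^sub>R e k) = 0"
    proof (rule KC)
      show "\<forall>k\<le>?n. (if k = i then 0 else if k < i then 0 else c k *\<^sub>R e k) \<in> C k"
        using e(3) C by (auto simp: I_def subspace_0 subspace_scale)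
      have "(\<Sum>k\<in>I. if k < i then 0 else c k *\<^sub>R e k) = (\<Sum>k\<in>I. c k *\<^sub>R e k)"
        using lt by (intro sum.cong) auto
      then show "(\<Sum>k\<le>?n. if k = i then 0 else if k < i then 0 else c k *\<^sub>R e k) = 0"
        unfolding sumI using c by simp
    qed (use k in \<open>auto simp: I_def\<close>)
    then show ?thesis using lt[of k] k e(1)[OF k] by (auto simp: I_def split: if_splits)
  qed
  have inj: "inj_on e I"
  proof (rule inj_onI, rule ccontr)
    fix a b assume ab: "a \<in> I" "b \<in> I" "e a = e b" "a \<noteq> b"
    define c where "c k = (if k = a then 1 else if k = b then -1 else 0 :: real)" for k
    have "(\<Sum>k\<in>I. c k *\<^sub>R e k) = (\<Sum>k\<in>{a, b}. c k *\<^sub>R e k)"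
      using ab finI by (intro sum.mono_neutral_right) (auto simp: c_def)
    also have "\<dots> = 0" using ab by (simp add: c_def)
    finally show False using indep[of c a] ab by (simp add: c_def)
  qed
  have "independent (e ` I)"
  proof
    assume "dependent (e ` I)"
    then obtain u w where u: "w \<in> e ` I" "u w \<noteq> 0" "(\<Sum>w\<in>e ` I. u w *\<^sub>R w) = 0"
      using dependent_finite[of "e ` I"] finI by auto
    then have "(\<Sum>k\<in>I. u (e k) *\<^sub>R e k) = 0" using inj by (simp add: sum.reindex)
    then show False using indep[of "u \<circ> e"] u by auto
  qed
  then have "dim (e ` I) = ?n" using inj cardI by (simp add: dim_eq_card_independent card_image)
  then have "span (e ` I) = UNIV" by (simp add: dim_eq_full)
  moreover have "span (e ` I) = range (\<lambda>u. \<Sum>w\<in>e ` I. u w *\<^sub>R w)"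
    using finI by (intro span_finite) auto
  ultimately have "\<exists>u. y = (\<Sum>w\<in>e ` I. u w *\<^sub>R w)" for y by blast
  then have "\<exists>c. y = (\<Sum>k\<in>I. c k *\<^sub>R e k)" for y
    using inj by (simp add: sum.reindex) metis
  then have "\<forall>y. \<exists>c. y = (\<Sum>k\<in>I. c k *\<^sub>R e k)" ..
  from choice[OF this] obtain r where r: "\<And>y. y = (\<Sum>k\<in>I. r y k *\<^sub>R e k)" by blast
  have r_eq: "r y k = c k" if "y = (\<Sum>k\<in>I. c k *\<^sub>R e k)" "k \<in> I" for y c k
  proof -
    have "(\<Sum>k\<in>I. (r y k - c k) *\<^sub>R e k) = 0"
      using that(1) r[of y] by (simp add: scaleR_left_diff_distrib sum_subtractf)
    then show ?thesis using indep[of "\<lambda>k. r y k - c k"] that(2) by simp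
  qed
  have r_lin: "r (a *\<^sub>R y + b *\<^sub>R z) k = a * r y k + b * r z k" if "k \<in> I" for a b y z k
  proof (rule r_eq[OF _ that])
    show "a *\<^sub>R y + b *\<^sub>R z = (\<Sum>k\<in>I. (a * r y k + b * r z k) *\<^sub>R e k)"
      using arg_cong[OF r[of y], of "scaleR a"] arg_cong[OF r[of z], of "scaleR b"]
      by (simp add: scaleR_left_distrib sum.distrib scaleR_sum_right)
  qed
  \<comment> \<open>Subtracting \<open>y\<close> in slot \<open>j\<close> from its own expansion
    gives a relation in \<open>D\<close>, with \<open>0\<close> placed in slot
    \<open>i\<close>.\<close>
  have RD: "r y k = 0" if y: "y \<in> D j" "j \<le> ?n" and k: "k < i" "k \<noteq> j" for y j k
  proof -
    define x where "x k = (if k = i then 0 else r y k *\<^sub>R e k) - (if k = j then y else 0)" for k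
    have "(\<Sum>k\<le>?n. x k) = 0"
      using y(2) r[of y] by (simp add: x_def sum_subtractf sumI)
    moreover have "\<forall>k\<le>?n. x k \<in> D k"
      using e(2) D y by (auto simp: x_def I_def subspace_0 subspace_scale subspace_diff subspace_neg)
    ultimately have "v \<bullet> x k = 0" using k KD by blast
    then show ?thesis using k i e(1)[of k] by (simp add: x_def I_def)
  qed
  \<comment> \<open>The same relation lies in \<open>C\<close> once the coordinates below
    \<open>i\<close> are known to vanish, since the remaining basis vectors come from
    \<open>C\<close>.\<close>
  have RC: "r y k = 0" if y: "y \<in> C j" "j \<le> ?n" "\<And>k. k < i \<Longrightarrow> r y k = 0"
    and k: "k \<in> I" "k \<noteq> j" for y j k
  proof (cases "k < i")
    case True
    then show ?thesis by (rule y(3))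
  next
    case False
    define x where "x k = (if k = i then 0 else if k < i then 0 else r y k *\<^sub>R e k)
      - (if k = j then y else 0)" for k
    have "(\<Sum>k\<in>I. if k < i then 0 else r y k *\<^sub>R e k) = (\<Sum>k\<in>I. r y k *\<^sub>R e k)"
      using y(3) by (intro sum.cong) auto
    then have "(\<Sum>k\<le>?n. x k) = 0"
      using y(2) r[of y] unfolding x_def sum_subtractf sumI by simp
    moreover have "\<forall>k\<le>?n. x k \<in> C k"
      using e(3) C y by (auto simp: x_def I_def subspace_0 subspace_scale subspace_diff subspace_neg)
    ultimately have "v \<bullet> x k = 0" using k KC by (simp add: I_def)
    then show ?thesis using k False e(1)[of k] by (auto simp: x_def I_def)
  qed
  have dim1: "dim (C j) = 1" if "y \<in> C j" "y \<noteq> 0" "C j \<subseteq> span {y}" for y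
  proof -
    have "span {y} \<subseteq> C j" using that C[OF j(1)] by (intro span_minimal) auto
    then have "C j = span {y}" using that(3) by blast
    then show ?thesis using that(2) by (simp add: dim_span)
  qed
  have jI: "j \<in> I" using j by (simp add: I_def)
  show ?thesis
  proof (cases "i < j")
    case True
    have "y \<in> span {e j}" if "y \<in> C j" for y
    proof -
      have "r y k = 0" if "k < i" for k
        using RD[of y j k] \<open>y \<in> C j\<close> CD[OF j(1)] j(1) that True by auto
      then have 0: "r y k = 0" if "k \<in> I" "k \<noteq> j" for k
        using RC[OF \<open>y \<in> C j\<close> j(1)] that by blast
      have "(\<Sum>k\<in>I. r y k *\<^sub>R e k) = (\<Sum>k\<in>{j}. r y k *\<^sub>R e k)"
        using 0 jI finI by (intro sum.mono_neutral_right) auto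
      then have "r y j *\<^sub>R e j = y" unfolding r[of y, symmetric] by simp
      moreover have "r y j *\<^sub>R e j \<in> span {e j}" by (intro span_scale span_base) simp
      ultimately show ?thesis by simp
    qed
    moreover have "e j \<noteq> 0" using e(1)[OF jI] by auto
    ultimately show ?thesis using dim1 e(3)[OF jI True] by blast
  next
    case False
    then have "j < i" using j by simp
    \<comment> \<open>For \<open>j < i\<close> the basis vector need only lie in \<open>D j\<close>,
      so instead of containment in its line one shows that coordinate \<open>j\<close> is injective
      on \<open>C j\<close>.\<close>
    have zero: "y = 0" if "y \<in> C j" "r y j = 0" for y
    proof -
      have lt: "r y k = 0" if "k < i" for k
        using RD[of y j k] \<open>y \<in> C j\<close> CD[OF j(1)] j(1) that \<open>r y j = 0\<close> by (cases "k = j") auto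
      then have "r y k = 0" if "k \<in> I" for k
        using RC[OF \<open>y \<in> C j\<close> j(1) lt] that \<open>r y j = 0\<close> by (cases "k = j") auto
      then show ?thesis using r[of y] by simp
    qed
    have "\<exists>y\<in>C j. y \<noteq> 0"
    proof (rule ccontr)
      assume "\<not> (\<exists>y\<in>C j. y \<noteq> 0)"
      then have Cj: "\<And>y. y \<in> C j \<Longrightarrow> y = 0" by blast
      \<comment> \<open>If \<open>C j\<close> were zero, the kernel of coordinate \<open>j\<close>
        would contain every \<open>C k\<close> and so be the whole space, although
        \<open>e j\<close> has coordinate \<open>1\<close>.\<close>
      define P where "P = {y. r y j = 0}"
      have r0: "r 0 j = 0" using r_eq[of 0 "\<lambda>_. 0" j] jI by simp
      have "r (y + z) j = r y j + r z j" "r (a *\<^sub>R y) j = a * r y j" for y z a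
        using r_lin[OF jI, of 1 y 1 z] r_lin[OF jI, of a y 0 y] by simp_all
      then have "subspace P" using r0 unfolding subspace_def P_def by simp
      moreover have "C k \<subseteq> P" if "k \<le> ?n" for k
      proof (cases "k = j")
        case True
        then show ?thesis using Cj r0 by (auto simp: P_def)
      next
        case False
        then show ?thesis using RD[of _ k j] CD[OF that] that \<open>j < i\<close> by (auto simp: P_def)
      qed
      ultimately have "e j \<in> P" using full by blast
      moreover have "(\<Sum>k\<in>I. (if k = j then 1 else 0) *\<^sub>R e k) =
          (\<Sum>k\<in>{j}. (if k = j then 1 else 0 :: real) *\<^sub>R e k)"
        using jI finI by (intro sum.mono_neutral_right) auto
      then have "e j = (\<Sum>k\<in>I. (if k = j then 1 else 0) *\<^sub>R e k)" by simp
      then have "r (e j) j = 1" using r_eq[of "e j" "\<lambda>k. if k = j then 1 else 0" j] jI by simp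
      ultimately show False by (simp add: P_def)
    qed
    then obtain y where y: "y \<in> C j" "y \<noteq> 0" by blast
    have ry: "r y j \<noteq> 0" using zero y by blast
    have "z \<in> span {y}" if z: "z \<in> C j" for z
    proof -
      define w where "w = 1 *\<^sub>R z + (- (r z j / r y j)) *\<^sub>R y"
      have "w \<in> C j" unfolding w_def using C[OF j(1)] y z
        by (intro subspace_add subspace_scale) auto
      moreover have "r w j = 0" unfolding w_def r_lin[OF jI] using ry by simp
      ultimately have "w = 0" by (rule zero)
      then have "(r z j / r y j) *\<^sub>R y = z" by (simp add: w_def)
      moreover have "(r z j / r y j) *\<^sub>R y \<in> span {y}" by (intro span_scale span_base) simp
      ultimately show ?thesis by simp
    qed
    then show ?thesis using dim1 y by blast
  qed
qed


section \<open>Admissibility\<close>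

definition truncate_from :: "nat \<Rightarrow> (nat \<Rightarrow> real) \<Rightarrow> nat \<Rightarrow> real" where
  "truncate_from i lam j = (if j < i then lam j else 0)"

lemma partial_lifting_linear:
  "partial_lifting (linear_lifting lam v) i = linear_lifting (truncate_from i lam) v"
  by (auto simp: partial_lifting_def truncate_from_def fun_eq_iff)

section \<open>Cells as Minkowski sums and uniqueness of their normals\<close>

lemma cell_sum_eq:
  fixes D :: "nat \<Rightarrow> 'a::euclidean_space set"
  shows "cell_sum D = {\<Sum>i\<le>DIM('a). s i | s. \<forall>i\<le>DIM('a). s i \<in> D i}"
  unfolding cell_sum_def set_sum_alt[OF finite_atMost] by (simp add: Ball_def)

lemma cell_sum_mono:
  fixes D :: "nat \<Rightarrow> 'a::euclidean_space set"
  assumes "\<And>j. j \<le> DIM('a) \<Longrightarrow> C j \<subseteq> D j"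
  shows "cell_sum C \<subseteq> cell_sum D"
proof
  fix x assume "x \<in> cell_sum C"
  then obtain s where "x = (\<Sum>i\<le>DIM('a). s i)" "\<forall>i\<le>DIM('a). s i \<in> C i"
    unfolding cell_sum_eq by blast
  then show "x \<in> cell_sum D" unfolding cell_sum_eq using assms by (auto intro!: exI[of _ s])
qed

text \<open>Adding the minimality inequalities of the two normals cancels the lifting heights and
  shows that \<open>w - u\<close> attains its minimum over the first cell at the interior point
  \<open>x\<close>. This forces \<open>w - u\<close> to be zero.\<close>

lemma cell_normal_unique:
  fixes P :: "nat \<Rightarrow> 'a::euclidean_space set"
  assumes int: "x \<in> interior (cell_sum (\<lambda>j. minimizers (P j) (u + \<mu> j *\<^sub>R v)))"
    and mem: "x \<in> cell_sum (\<lambda>j. minimizers (P j) (w + \<mu> j *\<^sub>R v))"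
  shows "u = w"
proof (rule ccontr)
  assume "u \<noteq> w"
  let ?n = "DIM('a)" and ?C = "cell_sum (\<lambda>j. minimizers (P j) (u + \<mu> j *\<^sub>R v))"
  have split: "(\<Sum>j\<le>?n. (q + \<mu> j *\<^sub>R v) \<bullet> s j) = q \<bullet> (\<Sum>j\<le>?n. s j) + (\<Sum>j\<le>?n. \<mu> j * (v \<bullet> s j))"
    for q and s :: "nat \<Rightarrow> 'a"
    by (simp add: inner_add_left sum.distrib inner_sum_right)
  obtain s where s: "x = (\<Sum>j\<le>?n. s j)" "\<forall>j\<le>?n. s j \<in> minimizers (P j) (u + \<mu> j *\<^sub>R v)"
    using interior_subset int unfolding cell_sum_eq by blast
  obtain t where t: "x = (\<Sum>j\<le>?n. t j)" "\<forall>j\<le>?n. t j \<in> minimizers (P j) (w + \<mu> j *\<^sub>R v)"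
    using mem unfolding cell_sum_eq by blast
  have "(w - u) \<bullet> x \<le> (w - u) \<bullet> z" if z: "z \<in> ?C" for z
  proof -
    obtain r where r: "z = (\<Sum>j\<le>?n. r j)" "\<forall>j\<le>?n. r j \<in> minimizers (P j) (u + \<mu> j *\<^sub>R v)"
      using z unfolding cell_sum_eq by blast
    have "(\<Sum>j\<le>?n. (u + \<mu> j *\<^sub>R v) \<bullet> r j) \<le> (\<Sum>j\<le>?n. (u + \<mu> j *\<^sub>R v) \<bullet> t j)"
      using r(2) t(2) by (intro sum_mono) (auto simp: minimizers_def)
    moreover have "(\<Sum>j\<le>?n. (w + \<mu> j *\<^sub>R v) \<bullet> t j) \<le> (\<Sum>j\<le>?n. (w + \<mu> j *\<^sub>R v) \<bullet> r j)"
      using r(2) t(2) by (intro sum_mono) (auto simp: minimizers_def)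
    ultimately show ?thesis
      unfolding split r(1)[symmetric] t(1)[symmetric] by (simp add: inner_diff_left)
  qed
  moreover obtain e where e: "e > 0" "ball x e \<subseteq> ?C"
    using int by (auto simp: mem_interior)
  \<comment> \<open>A step of length \<open>e / 2\<close> against \<open>w - u\<close> stays in the
    ball and would lower the functional.\<close>
  define z where "z = x - (e / 2 / norm (w - u)) *\<^sub>R (w - u)"
  have "z \<in> ?C" using e \<open>u \<noteq> w\<close> by (intro subsetD[OF e(2)]) (simp add: z_def dist_norm)
  ultimately have "(w - u) \<bullet> x \<le> (w - u) \<bullet> z" by blast
  then have "(e / 2 / norm (w - u)) * ((w - u) \<bullet> (w - u)) \<le> 0"
    unfolding z_def inner_diff_right inner_scaleR_right by linarith
  moreover have "(e / 2 / norm (w - u)) * ((w - u) \<bullet> (w - u)) > 0"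
    using e(1) \<open>u \<noteq> w\<close> by (intro mult_pos_pos) auto
  ultimately show False by linarith
qed

lemma directions_full:
  fixes C :: "nat \<Rightarrow> 'a::euclidean_space set"
  assumes "aff_dim (cell_sum C) = int DIM('a)"
    and P: "subspace P" "\<And>j. j \<le> DIM('a) \<Longrightarrow> directions (C j) \<subseteq> P"
  shows "P = UNIV"
proof -
  have "cell_sum C \<noteq> {}" using assms(1) by auto
  from aff_dim_eq_dim_directions[OF this] have "dim (directions (cell_sum C)) = DIM('a)"
    using assms(1) by simp
  then have "span (directions (cell_sum C)) = UNIV" by (simp add: dim_eq_full)
  moreover have "directions (cell_sum C) \<subseteq> P"
  proof (rule directions_subset[OF P(1)])
    fix x y assume "x \<in> cell_sum C" and y: "y \<in> cell_sum C"
    then obtain s where s: "x = (\<Sum>j\<le>DIM('a). s j)" "\<forall>j\<le>DIM('a). s j \<in> C j"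
      unfolding cell_sum_eq by blast
    obtain t where t: "y = (\<Sum>j\<le>DIM('a). t j)" "\<forall>j\<le>DIM('a). t j \<in> C j"
      using y unfolding cell_sum_eq by blast
    have "s j - t j \<in> P" if "j \<le> DIM('a)" for j
      using directions_diff[of "s j" "C j" "t j"] s(2) t(2) P(2)[OF that] that by blast
    then have "(\<Sum>j\<le>DIM('a). s j - t j) \<in> P"
      by (intro subspace_sum[OF P(1)]) simp
    then show "x - y \<in> P" by (simp add: s t sum_subtractf)
  qed
  then have "span (directions (cell_sum C)) \<subseteq> P" using P(1) by (rule span_minimal)
  ultimately show ?thesis by auto
qed

text \<open>Smallness of \<open>lam\<close> enters through \<open>refine\<close> and
  \<open>gap\<close>. The property \<open>relation\<close> of \<open>M\<close> is kept for arbitrary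
  \<open>\<mu>\<close>, so that it applies to \<open>lam\<close> and to its truncations. In
  \<open>gap\<close> the last index is left out because \<open>lam DIM('a)\<close> may be
  zero.\<close>

locale lifted_supports =
  fixes L :: "'a::euclidean_space set" and A :: "nat \<Rightarrow> 'a set" and v :: 'a and lam :: "nat \<Rightarrow> real"
    and M :: real
  assumes fin: "\<And>j. j \<le> DIM('a) \<Longrightarrow> finite (A j)"
    and sub: "\<And>j. j \<le> DIM('a) \<Longrightarrow> A j \<subseteq> L"
    and ne: "\<And>j. j \<le> DIM('a) \<Longrightarrow> A j \<noteq> {}"
    and v: "v \<notin> hyperplane_arrangement (newton_sum A)"
    and refine: "\<And>i u'. i \<le> DIM('a) \<Longrightarrow> \<exists>u. \<forall>j\<le>DIM('a).
        minimizers (A j) (u' + truncate_from (Suc i) lam j *\<^sub>R v)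
        \<subseteq> minimizers (A j) (u + truncate_from i lam j *\<^sub>R v)"
    and relation: "\<And>U \<mu> m x j. \<forall>j\<le>DIM('a). U j \<in> (\<Union>j\<le>DIM('a). directions ` Pow (A j)) \<Longrightarrow>
        \<forall>k<m. k \<le> DIM('a) \<longrightarrow> M * (\<Sum>j\<in>{k<..DIM('a)}. \<bar>\<mu> j\<bar>) < \<mu> k \<Longrightarrow>
        \<forall>x. (\<forall>j\<le>DIM('a). x j \<in> U j) \<longrightarrow> (\<Sum>j\<le>DIM('a). x j) = 0 \<longrightarrow>
          (\<Sum>j\<le>DIM('a). \<mu> j * (v \<bullet> x j)) = 0 \<Longrightarrow>
        \<forall>j\<le>DIM('a). x j \<in> U j \<Longrightarrow> (\<Sum>j\<le>DIM('a). x j) = 0 \<Longrightarrow> j < m \<Longrightarrow> j \<le> DIM('a) \<Longrightarrow> v \<bullet> x j = 0"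
    and gap: "\<And>k. k < DIM('a) \<Longrightarrow> M * (\<Sum>j\<in>{k<..DIM('a)}. \<bar>lam j\<bar>) < lam k"
    and M: "0 \<le> M"
begin

text \<open>Single refinements are composed downwards from \<open>Suc DIM('a)\<close>, where
  truncation no longer changes any relevant weight.\<close>

lemma refine_all:
  assumes "i \<le> Suc DIM('a)"
  shows "\<exists>u. \<forall>j\<le>DIM('a). minimizers (A j) (u' + lam j *\<^sub>R v)
    \<subseteq> minimizers (A j) (u + truncate_from i lam j *\<^sub>R v)"
  using assms
proof (induction rule: inc_induct)
  case base
  show ?case by (intro exI[of _ u']) (simp add: truncate_from_def)
next
  case (step i)
  then obtain w where w: "\<forall>j\<le>DIM('a). minimizers (A j) (u' + lam j *\<^sub>R v)
    \<subseteq> minimizers (A j) (w + truncate_from (Suc i) lam j *\<^sub>R v)" by blast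
  obtain u where "\<forall>j\<le>DIM('a). minimizers (A j) (w + truncate_from (Suc i) lam j *\<^sub>R v)
    \<subseteq> minimizers (A j) (u + truncate_from i lam j *\<^sub>R v)" using refine[of i w] step by auto
  then show ?case using w by (intro exI[of _ u]) (meson order_trans)
qed

lemma components:
  assumes "j \<le> DIM('a)"
  shows "cell_components A (linear_lifting \<mu> v) u j = convex hull (minimizers (A j) (u + \<mu> j *\<^sub>R v))"
  using fin[OF assms] by (simp add: cell_components_linear_lifting minimizers_convex_hull)

lemma refined_byI:
  assumes "\<And>u'. \<exists>u. \<forall>j\<le>DIM('a). minimizers (A j) (u' + \<mu>' j *\<^sub>R v) \<subseteq> minimizers (A j) (u + \<mu> j *\<^sub>R v)"
  shows "mixed_subdivision A (linear_lifting \<mu> v) \<preceq> mixed_subdivision A (linear_lifting \<mu>' v)"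
  unfolding refined_by_def
proof
  fix C assume "C \<in> mixed_subdivision A (linear_lifting \<mu>' v)"
  then obtain u' where C: "C = cell_sum (cell_components A (linear_lifting \<mu>' v) u')"
    by (auto simp: mixed_subdivision_eq decomposed_cells_def)
  obtain u where u: "\<forall>j\<le>DIM('a). minimizers (A j) (u' + \<mu>' j *\<^sub>R v) \<subseteq> minimizers (A j) (u + \<mu> j *\<^sub>R v)"
    using assms by blast
  have "C \<subseteq> cell_sum (cell_components A (linear_lifting \<mu> v) u)"
    unfolding C by (rule cell_sum_mono) (simp add: components u hull_mono)
  then show "\<exists>D\<in>mixed_subdivision A (linear_lifting \<mu> v). C \<subseteq> D"
    by (auto simp: mixed_subdivision_eq decomposed_cells_def)
qed

lemma aff_dim_component_eq_0:
  assumes "j \<le> DIM('a)"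
  shows "aff_dim (cell_components A (linear_lifting \<mu> v) u j) = 0 \<longleftrightarrow>
    directions (minimizers (A j) (u + \<mu> j *\<^sub>R v)) = {0}"
proof -
  have "convex hull (minimizers (A j) (u + \<mu> j *\<^sub>R v)) \<noteq> {}"
    using minimizers_nonempty[OF fin ne] assms by simp
  then show ?thesis
    unfolding components[OF assms] aff_dim_eq_0
    by (simp add: directions_eq_0_iff[symmetric] directions_convex_hull)
qed

lemma exists_direction:
  assumes "j \<le> DIM('a)" "directions (minimizers (A j) w) \<noteq> {0}"
  shows "\<exists>x\<in>directions (minimizers (A j) w). v \<bullet> x \<noteq> 0"
proof (rule ccontr)
  assume "\<not> ?thesis"
  then have "directions (minimizers (A j) w) \<subseteq> {x. v \<bullet> x = 0}" by blast
  then show False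
    using constant_face_in_arrangement[where A = A, OF _ _ assms] fin ne v by blast
qed

section \<open>Mixed cells from relations between their components\<close>

lemma relation_minimizers:
  assumes gap: "\<And>k. k < m \<Longrightarrow> k \<le> DIM('a) \<Longrightarrow> M * (\<Sum>j\<in>{k<..DIM('a)}. \<bar>\<mu> j\<bar>) < \<mu> k"
    and x: "\<forall>j\<le>DIM('a). x j \<in> directions (minimizers (A j) (u + \<mu> j *\<^sub>R v))"
      "(\<Sum>j\<le>DIM('a). x j) = 0" and j: "j < m" "j \<le> DIM('a)"
  shows "v \<bullet> x j = 0"
proof (rule relation[where U = "\<lambda>j. directions (minimizers (A j) (u + \<mu> j *\<^sub>R v))"])
  show "\<forall>j\<le>DIM('a). directions (minimizers (A j) (u + \<mu> j *\<^sub>R v)) \<in> (\<Union>j\<le>DIM('a). directions ` Pow (A j))"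
    by (auto simp: minimizers_def intro!: image_eqI)
  show "\<forall>y. (\<forall>j\<le>DIM('a). y j \<in> directions (minimizers (A j) (u + \<mu> j *\<^sub>R v))) \<longrightarrow>
      (\<Sum>j\<le>DIM('a). y j) = 0 \<longrightarrow> (\<Sum>j\<le>DIM('a). \<mu> j * (v \<bullet> y j)) = 0"
  proof (intro allI impI)
    fix y assume y: "\<forall>j\<le>DIM('a). y j \<in> directions (minimizers (A j) (u + \<mu> j *\<^sub>R v))"
      and sum: "(\<Sum>j\<le>DIM('a). y j) = 0"
    have "(\<Sum>j\<le>DIM('a). \<mu> j * (v \<bullet> y j)) = (\<Sum>j\<le>DIM('a). (u + \<mu> j *\<^sub>R v) \<bullet> y j - u \<bullet> y j)"
      by (simp add: inner_add_left)
    also have "\<dots> = (\<Sum>j\<le>DIM('a). - (u \<bullet> y j))"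
      using y minimizers_orthogonal by (intro sum.cong) auto
    also have "\<dots> = - (u \<bullet> (\<Sum>j\<le>DIM('a). y j))" by (simp add: inner_sum_right sum_negf)
    finally show "(\<Sum>j\<le>DIM('a). \<mu> j * (v \<bullet> y j)) = 0" using sum by simp
  qed
qed (use gap in blast, (rule x j)+)

lemma mixed_component_dims:
  assumes i: "i \<le> DIM('a)"
    and CD: "\<And>j. j \<le> DIM('a) \<Longrightarrow> minimizers (A j) (w + lam j *\<^sub>R v)
      \<subseteq> minimizers (A j) (u + truncate_from i lam j *\<^sub>R v)"
    and full: "aff_dim (cell_sum (cell_components A (linear_lifting lam v) w)) = int DIM('a)"
    and C_pos: "\<And>j. i < j \<Longrightarrow> j \<le> DIM('a) \<Longrightarrow> directions (minimizers (A j) (w + lam j *\<^sub>R v)) \<noteq> {0}"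
    and D_pos: "\<And>j. j < i \<Longrightarrow> directions (minimizers (A j) (u + truncate_from i lam j *\<^sub>R v)) \<noteq> {0}"
    and j: "j \<le> DIM('a)" "j \<noteq> i"
  shows "aff_dim (cell_components A (linear_lifting lam v) w j) = 1"
proof -
  let ?C = "\<lambda>j. directions (minimizers (A j) (w + lam j *\<^sub>R v))"
  let ?D = "\<lambda>j. directions (minimizers (A j) (u + truncate_from i lam j *\<^sub>R v))"
  have "dim (?C j) = 1"
  proof (rule mixed_dimensions[where C = ?C and D = ?D and i = i and v = v])
    show "v \<bullet> x j = 0" if x: "\<forall>j\<le>DIM('a). x j \<in> ?D j" "(\<Sum>j\<le>DIM('a). x j) = 0" "j < i" for x j
    proof (rule relation_minimizers[where m = i and \<mu> = "truncate_from i lam"])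
      fix k assume k: "k < i" "k \<le> DIM('a)"
      \<comment> \<open>Truncation only shortens the tails and keeps the weights below
        \<open>i\<close>, so the gap survives there.\<close>
      have "(\<Sum>j\<in>{k<..DIM('a)}. \<bar>truncate_from i lam j\<bar>) \<le> (\<Sum>j\<in>{k<..DIM('a)}. \<bar>lam j\<bar>)"
        by (intro sum_mono) (simp add: truncate_from_def)
      then have "M * (\<Sum>j\<in>{k<..DIM('a)}. \<bar>truncate_from i lam j\<bar>) \<le> M * (\<Sum>j\<in>{k<..DIM('a)}. \<bar>lam j\<bar>)"
        using M by (rule mult_left_mono)
      also have "\<dots> < lam k" using k i by (intro gap) auto
      finally show "M * (\<Sum>j\<in>{k<..DIM('a)}. \<bar>truncate_from i lam j\<bar>) < truncate_from i lam k"
        using k by (simp add: truncate_from_def)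
    qed (use x i in auto)
    have lt: "v \<bullet> x j = 0" if x: "\<forall>j\<le>DIM('a). x j \<in> ?C j" "(\<Sum>j\<le>DIM('a). x j) = 0" "j < DIM('a)" for x j
      by (rule relation_minimizers[where m = "DIM('a)" and \<mu> = lam]) (use x gap in auto)
    show "v \<bullet> x j = 0" if x: "\<forall>j\<le>DIM('a). x j \<in> ?C j" "(\<Sum>j\<le>DIM('a). x j) = 0" "j \<le> DIM('a)" for x j
    proof (cases "j < DIM('a)")
      case False
      \<comment> \<open>The last index has no gap condition. Its pairing is recovered from the
        others because the vectors sum to zero.\<close>
      have "(\<Sum>j\<le>DIM('a). x j) = (\<Sum>j<DIM('a). x j) + x DIM('a)"
        by (simp add: lessThan_Suc_atMost[symmetric])
      then have "v \<bullet> x DIM('a) = - (\<Sum>j<DIM('a). v \<bullet> x j)"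
        using x(2) by (metis add.inverse_unique add.commute inner_minus_right inner_sum_right)
      also have "\<dots> = 0" using lt[OF x(1,2)] by simp
      finally show ?thesis using False x(3) by simp
    qed (use lt x in blast)
    show "P = UNIV" if "subspace P" "\<And>j. j \<le> DIM('a) \<Longrightarrow> ?C j \<subseteq> P" for P
      using that by (intro directions_full[OF full]) (simp_all add: components directions_convex_hull)
  qed (use i j CD C_pos D_pos exists_direction in \<open>auto simp: subspace_directions intro!: directions_mono\<close>)
  moreover have "convex hull (minimizers (A j) (w + lam j *\<^sub>R v)) \<noteq> {}"
    using minimizers_nonempty[OF fin ne] j by simp
  ultimately show ?thesis
    unfolding components[OF j(1)] by (simp add: aff_dim_eq_dim_directions directions_convex_hull)
qed

text \<open>This is alternative (i) of admissibility: a point component cuts its support down to one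
  lattice point, the case of \<open>fundamental_subfamily_singleton_support\<close>.\<close>

lemma point_component_fundamental:
  assumes j: "j \<le> DIM('a)" and D: "aff_dim (cell_components A (linear_lifting \<mu> v) u j) = 0"
  shows "card (fundamental_subfamily L (restricted_supports A (cell_components A (linear_lifting \<mu> v) u))) \<le> 1"
proof -
  let ?w = "u + \<mu> j *\<^sub>R v"
  have ne': "minimizers (A j) ?w \<noteq> {}" using minimizers_nonempty[OF fin ne] j by blast
  obtain a where a: "minimizers (A j) ?w = {a}"
    using D aff_dim_component_eq_0[OF j] directions_eq_0_iff[OF ne'] by blast
  have aA: "a \<in> A j" using a by (auto simp: minimizers_def)
  then have "restricted_supports A (cell_components A (linear_lifting \<mu> v) u) j = {a}"
    by (auto simp: restricted_supports_def components[OF j] a)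
  moreover have "a \<in> L" using aA sub[OF j] by blast
  ultimately have "fundamental_subfamily L (restricted_supports A (cell_components A (linear_lifting \<mu> v) u)) \<subseteq> {j}"
    using j by (intro fundamental_subfamily_singleton_support)
  then show ?thesis using card_mono[of "{j}"] by simp
qed

lemma admissible_level:
  assumes i: "i \<le> DIM('a)"
  shows "admissible_level L A (linear_lifting lam v) \<delta> i (linear_lifting (truncate_from i lam) v)"
  unfolding admissible_level_def
proof
  let ?\<rho> = "linear_lifting lam v" and ?\<theta> = "linear_lifting (truncate_from i lam) v"
  fix D assume "D \<in> n_cells A ?\<theta>"
  then obtain u where D: "D = cell_components A ?\<theta> u"
    by (auto simp: n_cells_def decomposed_cells_def)
  show "card (fundamental_subfamily L (restricted_supports A D)) \<le> 1 \<or>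
    row_points L A ?\<rho> \<delta> D i \<subseteq> \<Union> {translated_cell \<delta> C | C. C \<in> restricted_n_cells A ?\<rho> D \<and> i_mixed i C}"
  proof (cases "\<exists>j<i. aff_dim (D j) = 0")
    case True
    then obtain j where "j < i" "aff_dim (D j) = 0" by blast
    then show ?thesis using point_component_fundamental[of j "truncate_from i lam" u] i D by simp
  next
    case False
    have "b \<in> \<Union> {translated_cell \<delta> C | C. C \<in> restricted_n_cells A ?\<rho> D \<and> i_mixed i C}"
      if b: "b \<in> row_points L A ?\<rho> \<delta> D i" for b
    proof -
      have bD: "b \<in> translated_cell \<delta> D" using b by (simp add: row_points_def)
      obtain C where C: "C \<in> n_cells A ?\<rho>" "b \<in> interior (translated_cell \<delta> C)" "aff_dim (C i) = 0"
        "\<And>j. j \<le> DIM('a) \<Longrightarrow> aff_dim (C j) = 0 \<Longrightarrow> j \<le> i"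
        using b by (auto simp: row_points_def has_row_content_def)
      obtain w where Cw: "C = cell_components A ?\<rho> w"
        using C(1) by (auto simp: n_cells_def decomposed_cells_def)
      obtain u' where u': "\<forall>j\<le>DIM('a). minimizers (A j) (w + lam j *\<^sub>R v)
          \<subseteq> minimizers (A j) (u' + truncate_from i lam j *\<^sub>R v)"
        using refine_all[of i w] i by auto
      have Csub: "C j \<subseteq> cell_components A ?\<theta> u' j" if "j \<le> DIM('a)" for j
        using u' that by (simp add: Cw components hull_mono)
      \<comment> \<open>Refinement places \<open>C\<close> in some coarse cell with normal
        \<open>u'\<close>. Since \<open>x\<close> is interior to that cell and lies in
        \<open>D\<close>, uniqueness of normals identifies it with \<open>D\<close>.\<close>
      obtain x where x: "b = \<delta> + x" "x \<in> interior (cell_sum C)"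
        using C(2) by (auto simp: translated_cell_def interior_translation)
      have "cell_sum C \<subseteq> cell_sum (cell_components A ?\<theta> u')"
        by (rule cell_sum_mono) (rule Csub)
      then have "x \<in> interior (cell_sum (cell_components A ?\<theta> u'))"
        using x(2) interior_mono by blast
      moreover have "x \<in> cell_sum D" using bD x(1) by (auto simp: translated_cell_def)
      ultimately have "u' = u"
        unfolding D cell_components_linear_lifting by (rule cell_normal_unique)
      have "C \<in> restricted_n_cells A ?\<rho> D"
        using C(1) Csub by (simp add: restricted_n_cells_def D \<open>u' = u\<close> cell_sum_mono)
      moreover have "i_mixed i C"
      proof -
        have "aff_dim (C j) = 1" if j: "j \<le> DIM('a)" "j \<noteq> i" for j
          unfolding Cw
        proof (rule mixed_component_dims[OF i])
          show "aff_dim (cell_sum (cell_components A ?\<rho> w)) = int DIM('a)"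
            using C(1) by (simp add: n_cells_def Cw)
          \<comment> \<open>Components beyond the row content \<open>i\<close> are not points;
            components of \<open>D\<close> below \<open>i\<close> are not points by the case
            assumption.\<close>
          show "directions (minimizers (A j) (w + lam j *\<^sub>R v)) \<noteq> {0}" if "i < j" "j \<le> DIM('a)" for j
            using C(4)[of j] that aff_dim_component_eq_0[of j lam w] by (auto simp: Cw)
          show "directions (minimizers (A j) (u + truncate_from i lam j *\<^sub>R v)) \<noteq> {0}" if "j < i" for j
            using False that i aff_dim_component_eq_0[of j "truncate_from i lam" u] by (auto simp: D)
        qed (use u' \<open>u' = u\<close> j in auto)
        then show ?thesis using C(3) by (simp add: i_mixed_def)
      qed
      moreover have "b \<in> translated_cell \<delta> C" using C(2) interior_subset by blast
      ultimately show ?thesis by blast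
    qed
    then show ?thesis by blast
  qed
qed

lemma admissible: "admissible L A (linear_lifting lam v) \<delta>"
  unfolding admissible_def incremental_chain_def partial_lifting_linear
proof (intro conjI allI impI)
  show "mixed_subdivision A (linear_lifting (truncate_from i lam) v)
      \<preceq> mixed_subdivision A (linear_lifting (truncate_from (Suc i) lam) v)" if "i < DIM('a)" for i
    using refine that by (intro refined_byI) simp
  show "mixed_subdivision A (linear_lifting (truncate_from DIM('a) lam) v)
      \<preceq> mixed_subdivision A (linear_lifting lam v)"
    using refine_all[of "DIM('a)"] by (intro refined_byI) simp
qed (rule admissible_level)

end

section \<open>Choice of the thresholds\<close>

lemma gap_of_ratio:
  fixes lam :: "nat \<Rightarrow> real"
  assumes M: "0 \<le> M" and dec: "\<And>i. i < n \<Longrightarrow> lam (Suc i) < lam i" and nn: "0 \<le> lam n"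
    and ratio: "lam (Suc k) < lam k / (M * real n + 1)" and k: "k < n"
  shows "M * (\<Sum>j\<in>{k<..n}. \<bar>lam j\<bar>) < lam k"
proof -
  have anti: "lam b \<le> lam a" if "a \<le> b" "b \<le> n" for a b
    using that
  proof (induction rule: dec_induct)
    case (step m)
    then show ?case using dec[of m] by simp
  qed simp
  \<comment> \<open>The tail is nonnegative and decreasing, so each of its at most \<open>n\<close>
    terms is bounded by \<open>lam (Suc k)\<close>.\<close>
  have "(\<Sum>j\<in>{k<..n}. \<bar>lam j\<bar>) \<le> (\<Sum>j\<in>{k<..n}. lam (Suc k))"
  proof (rule sum_mono)
    fix j assume "j \<in> {k<..n}"
    then show "\<bar>lam j\<bar> \<le> lam (Suc k)" using anti[of "Suc k" j] anti[of j n] nn by auto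
  qed
  also have "\<dots> \<le> real n * lam (Suc k)"
    using anti[of "Suc k" n] nn k by (simp add: mult_right_mono)
  finally have "M * (\<Sum>j\<in>{k<..n}. \<bar>lam j\<bar>) \<le> M * (real n * lam (Suc k))"
    using M by (rule mult_left_mono)
  also have "\<dots> < lam k"
  proof -
    have "0 < M * real n + 1" using M by (simp add: add_nonneg_pos)
    then have "lam (Suc k) * (M * real n + 1) < lam k" using ratio by (simp add: pos_less_divide_eq)
    moreover have "0 \<le> lam (Suc k)" using anti[of "Suc k" n] nn k by simp
    ultimately show ?thesis by (simp add: algebra_simps)
  qed
  finally show ?thesis .
qed

theorem theorem2p4:
  fixes L :: "'a::euclidean_space set" and A :: "nat \<Rightarrow> 'a set" and v :: 'a
  assumes "full_lattice L"
    and "\<forall>i\<le>DIM('a). finite (A i) \<and> A i \<subseteq> L"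
    and "aff_dim (newton_sum A) = int DIM('a)"
    and "v \<notin> hyperplane_arrangement (newton_sum A)"
  shows "\<exists>\<epsilon> :: real list \<Rightarrow> real. (\<forall>xs. \<epsilon> xs > 0) \<and>
    (\<forall>(lam :: nat \<Rightarrow> real) (\<delta> :: 'a).
       (\<forall>i<DIM('a). lam (Suc i) < lam i) \<longrightarrow>
       0 \<le> lam DIM('a) \<longrightarrow>
       successively_below DIM('a) \<epsilon> lam \<longrightarrow>
       generic_shift L A (\<lambda>i x. lam i * (v \<bullet> x)) \<delta> \<longrightarrow>
       admissible L A (\<lambda>i x. lam i * (v \<bullet> x)) \<delta>)"
proof -
  let ?n = "DIM('a)"
  have fin: "finite (A j)" if "j \<le> ?n" for j using assms(2) that by blast
  have ne: "A j \<noteq> {}" if "j \<le> ?n" for j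
  proof
    assume "A j = {}"
    then have "newton_sum A = {}" using that by (auto simp: newton_sum_def cell_sum_eq)
    then show False using assms(3) by simp
  qed
  \<comment> \<open>Every direction space of a face, for any lifting, belongs to this finite
    collection, so \<open>M\<close> can be fixed before \<open>lam\<close>.\<close>
  define \<V> where "\<V> = (\<Union>j\<le>?n. directions ` Pow (A j))"
  have "finite \<V>" unfolding \<V>_def using fin by auto
  from relation_threshold[OF this, of ?n v] obtain M where M: "0 \<le> M"
    "\<forall>U \<mu> m. (\<forall>j\<le>?n. U j \<in> \<V>) \<longrightarrow>
      (\<forall>k<m. k \<le> ?n \<longrightarrow> M * (\<Sum>j\<in>{k<..?n}. \<bar>\<mu> j\<bar>) < \<mu> k) \<longrightarrow>
      (\<forall>x. (\<forall>j\<le>?n. x j \<in> U j) \<longrightarrow> (\<Sum>j\<le>?n. x j) = 0 \<longrightarrow> (\<Sum>j\<le>?n. \<mu> j * (v \<bullet> x j)) = 0) \<longrightarrow>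
      (\<forall>x. (\<forall>j\<le>?n. x j \<in> U j) \<longrightarrow> (\<Sum>j\<le>?n. x j) = 0 \<longrightarrow> (\<forall>j<m. j \<le> ?n \<longrightarrow> v \<bullet> x j = 0))"
    by (elim exE conjE)
  \<comment> \<open>The pair \<open>p\<close> holds the index being switched on and the weights
    chosen before it.\<close>
  have "\<forall>p. \<exists>\<epsilon>. \<epsilon> > 0 \<and> (\<forall>t u'. \<bar>t\<bar> < \<epsilon> \<longrightarrow> (\<exists>u. \<forall>j\<le>?n.
      minimizers (A j) (u' + ((snd p)(fst p := t)) j *\<^sub>R v)
      \<subseteq> minimizers (A j) (u + ((snd p)(fst p := 0)) j *\<^sub>R v)))"
    using minimizers_refine[where A = A and n = ?n and v = v] fin by simp
  from choice[OF this] obtain E where E: "\<And>p. E p > 0" "\<And>p t u'. \<bar>t\<bar> < E p \<Longrightarrow> \<exists>u. \<forall>j\<le>?n.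
      minimizers (A j) (u' + ((snd p)(fst p := t)) j *\<^sub>R v)
      \<subseteq> minimizers (A j) (u + ((snd p)(fst p := 0)) j *\<^sub>R v)" by blast
  \<comment> \<open>The list holds the earlier weights and its length is the current index. The
    first bound secures refinement, the second the gap; the default \<open>1\<close> keeps the
    threshold positive on lists without a positive last entry.\<close>
  define \<epsilon> where "\<epsilon> xs = min (E (length xs, truncate_from (length xs) (nth xs)))
    (if xs \<noteq> [] \<and> last xs > 0 then last xs / (M * real ?n + 1) else 1)" for xs
  have Mn: "M * real ?n + 1 > 0" using M(1) by (simp add: add_nonneg_pos)
  show ?thesis
  proof (intro exI[of _ \<epsilon>] conjI allI impI)
    show "\<epsilon> xs > 0" for xs using E(1) Mn by (simp add: \<epsilon>_def)
  next
    fix lam :: "nat \<Rightarrow> real" and \<delta> :: 'a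
    assume dec: "\<forall>i<?n. lam (Suc i) < lam i" and nn: "0 \<le> lam ?n"
      and below: "successively_below ?n \<epsilon> lam"
    have pos: "0 \<le> lam i" if "i \<le> ?n" for i
      using that
    proof (induction rule: inc_induct)
      case (step k)
      then show ?case using dec by (meson less_imp_le order_trans)
    qed (rule nn)
    interpret lifted_supports L A v lam M
    proof
      fix i u' assume i: "i \<le> ?n"
      have trunc: "truncate_from i ((!) (map lam [0..<i])) = truncate_from i lam"
        by (auto simp: truncate_from_def)
      have "lam i < \<epsilon> (map lam [0..<i])"
        using below i by (simp add: successively_below_def)
      then have "lam i < E (i, truncate_from i lam)"
        unfolding \<epsilon>_def length_map length_upt diff_zero trunc by simp
      then have "\<bar>lam i\<bar> < E (i, truncate_from i lam)" using pos[OF i] by simp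
      moreover have "(truncate_from i lam)(i := lam i) = truncate_from (Suc i) lam"
        "(truncate_from i lam)(i := 0) = truncate_from i lam"
        by (auto simp: truncate_from_def)
      ultimately show "\<exists>u. \<forall>j\<le>?n. minimizers (A j) (u' + truncate_from (Suc i) lam j *\<^sub>R v)
          \<subseteq> minimizers (A j) (u + truncate_from i lam j *\<^sub>R v)"
        using E(2)[of "lam i" "(i, truncate_from i lam)" u'] by (simp del: fun_upd_apply)
    next
      fix k assume k: "k < ?n"
      \<comment> \<open>Strict positivity selects the branch of the threshold that bounds the ratio
        of consecutive weights.\<close>
      have "lam k > 0" using dec pos[of "Suc k"] k by force
      moreover have "lam (Suc k) < \<epsilon> (map lam [0..<Suc k])"
        using below k by (simp add: successively_below_def del: upt_Suc)
      moreover have "last (map lam [0..<Suc k]) = lam k" "map lam [0..<Suc k] \<noteq> []"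
        by simp_all
      ultimately have "lam (Suc k) < lam k / (M * real ?n + 1)"
        unfolding \<epsilon>_def by (simp del: upt_Suc)
      then show "M * (\<Sum>j\<in>{k<..?n}. \<bar>lam j\<bar>) < lam k"
        using M(1) dec nn k by (intro gap_of_ratio) auto
    next
      fix U :: "nat \<Rightarrow> 'a set" and \<mu> m x j
      assume "\<forall>j\<le>?n. U j \<in> (\<Union>j\<le>?n. directions ` Pow (A j))"
        "\<forall>k<m. k \<le> ?n \<longrightarrow> M * (\<Sum>j\<in>{k<..?n}. \<bar>\<mu> j\<bar>) < \<mu> k"
        "\<forall>x. (\<forall>j\<le>?n. x j \<in> U j) \<longrightarrow> (\<Sum>j\<le>?n. x j) = 0 \<longrightarrow> (\<Sum>j\<le>?n. \<mu> j * (v \<bullet> x j)) = 0"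
        "\<forall>j\<le>?n. x j \<in> U j" "(\<Sum>j\<le>?n. x j) = 0" "j < m" "j \<le> ?n"
      then show "v \<bullet> x j = 0" using M(2)[folded \<V>_def] unfolding \<V>_def[symmetric] by blast
    qed (use assms(2,4) fin ne M(1) in auto)
    show "admissible L A (\<lambda>i x. lam i * (v \<bullet> x)) \<delta>" by (rule admissible)
  qed
qed

end
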